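(* Let $\nu\ge0$ be an integer. Then for all real $z>0$, $$\begin{aligned}I_1(z,\nu)={}&\Gamma(1+\nu)\sum_{r=0}^{\nu}\frac{1}{\left(\frac12\right)_r(-\nu)_r\,r!}\left(-\frac{z^2}{4}\right)^r-2\,\Gamma\left(\tfrac12+\nu\right)\left(\frac{z^2}{4}\right)^{1/2}{}_0F_2\left(-;\tfrac32,\tfrac12-\nu;-\frac{z^2}{4}\right)\\&+\pi^{-1/2}\left(\frac{z^2}{4}\right)^{1+\nu}\sum_{r=0}^\infty\left(\frac{z^2}{4}\right)^r\left[-\log\left(\frac{z^2}{4}\right)+A_r\right]B_r,\end{aligned}$$ where $$A_r=\left[1+\frac12+\cdots+\frac1r\right]+\left[1+\frac12+\cdots+\frac1{r+\nu+1}\right]+\left[\frac1{1/2}+\frac1{3/2}+\cdots+\frac1{(1/2)+\nu+r}\right]-3\gamma-2\log2$$ (with $[1+\frac12+\cdots+\frac1r]$ taken to be $0$ if $r=0$), and $$B_r=\frac{(-1)^{1+\nu+r}\,\Gamma\left(-\frac12-\nu\right)}{r!\,(r+\nu+1)!\left(\frac32+\nu\right)_r}.$$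
   Context: $I_1(z,\nu)=\int_0^\infty y^\nu e^{-y}e^{-zy^{-1/2}}\,dy$. $\gamma=0.5772156649\ldots$ is Euler's constant and $\log$ is the natural logarithm. Pochhammer symbol: $(a)_0=1$ and $(a)_r=a(a+1)\cdots(a+r-1)$ for integers $r\ge1$. Hypergeometric function: ${}_0F_2(-;a,b;x)=\sum_{r=0}^\infty\frac{x^r}{(a)_r(b)_r\,r!}$. $\Gamma$ is the gamma function, extended analytically to the complex plane minus the non-positive integers. *)

theory Defs
  imports "HOL-Analysis.Analysis"
begin

definition I1 :: "real \<Rightarrow> real \<Rightarrow> real" where
  "I1 z \<nu> = (LBINT y:{0<..}. y powr \<nu> * exp (- y) * exp (- z * y powr (- 1 / 2)))"

definition hyp0F2_term :: "real \<Rightarrow> real \<Rightarrow> real \<Rightarrow> nat \<Rightarrow> real" where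
  "hyp0F2_term a b x r = x ^ r / (pochhammer a r * pochhammer b r * fact r)"

definition hyp0F2 :: "real \<Rightarrow> real \<Rightarrow> real \<Rightarrow> real" where
  "hyp0F2 a b x = (\<Sum>r. hyp0F2_term a b x r)"

definition A_coeff :: "nat \<Rightarrow> nat \<Rightarrow> real" where
  "A_coeff \<nu> r = harm r + harm (r + \<nu> + 1) + (\<Sum>k=0..\<nu> + r. 1 / (1 / 2 + real k))
             - 3 * euler_mascheroni - 2 * ln 2"

definition B_coeff :: "nat \<Rightarrow> nat \<Rightarrow> real" where
  "B_coeff \<nu> r = (- 1) ^ (1 + \<nu> + r) * Gamma (- 1 / 2 - real \<nu>)
             / (fact r * fact (r + \<nu> + 1) * pochhammer (3 / 2 + real \<nu>) r)"

text \<open>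
  Lebesgue integrals and \<^const>\<open>suminf\<close> have default values when they do not converge.
  \<open>I1_converges\<close> and the summability of the series are therefore to be asserted alongside any
  identity in which they occur.
\<close>

definition I1_converges :: "real \<Rightarrow> real \<Rightarrow> bool" where
  "I1_converges z \<nu> \<longleftrightarrow>
     set_integrable lborel {0<..} (\<lambda>y. y powr \<nu> * exp (- y) * exp (- z * y powr (- 1 / 2)))"

end

(*
  Let F_nu(z) = I_1(z, nu). Differentiating under the integral gives F_nu'' = F_(nu-1), and an
  integration by parts gives z F_0''' = -2 F_0. The right-hand side G_nu of the theorem, rearranged as
  a power series plus ln z times a power series, satisfies the same equations. For nu = 0 the
  difference D = F_0 - G_0 satisfies z D''' = -2 D, and D, D', D'' tend to 0 at 0+; iterating the
  estimate |D''(z)| <= c z^n gives D = 0. The limit that needs work is that of F_0''(z) + 2 ln z,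
  which is -3 gamma: integrate 1/y by parts, substitute u = z / sqrt y in one of the two terms, and
  use that the integral of e^(-y) ln y is -gamma. For the step to nu + 1, both sides have the same
  second derivative and the same limits at 0+ of the value and of the first derivative.
*)

theory Submission
  imports Defs "HOL-Real_Asymp.Real_Asymp"
begin

subsection \<open>Integrals with an exponential weight\<close>

text \<open>Expanding \<open>exp (- z * y powr (- 1 / 2))\<close> under the integral fails, since
  \<open>y powr (\<nu> - k / 2)\<close> is not integrable at 0 for large k; hence the detour through
  a differential equation. Integrating the y-derivative of y^mu e^(-y) e^(-z/sqrt y) gives F_mu = mu
  F_(mu-1) + (z/2) F_(mu-3/2), so that z F_nu''' = 2 nu F_nu'' - 2 F_nu. This is singular at 0 with
  exponents 0, 1 and 2 nu + 2: value and first derivative at 0 leave one constant open, at order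
  z^(2 nu + 2). For nu = 0 that order is 2, and the constant can be read off the second derivative
  once its term -2 ln z is removed. For larger nu it is buried under terms of lower order, so the
  equation is used at nu = 0 only and the other cases are reached by integrating twice. Of the three
  gammas, one comes from the term that is not substituted and two from the other, because u = z /
  sqrt y turns ln y into 2 ln z - 2 ln u.\<close>

lemma set_integral_powr_exp:
  fixes a :: real
  assumes "a > -1"
  shows "set_integrable lborel {0<..} (\<lambda>y. y powr a * exp (-y))"
    and "(LBINT y:{0<..}. y powr a * exp (-y)) = Gamma (a + 1)"
proof -
  have hi: "((\<lambda>y. y powr a * exp (-y)) has_integral Gamma (a + 1)) {0..}"
    using Gamma_integral_real[of "a + 1"] assms by (simp add: exp_minus divide_inverse)
  have "((\<lambda>y. if y \<in> {0<..} then y powr a * exp (-y) else 0) has_integral Gamma (a + 1)) {0..}"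
    using hi by (rule has_integral_spike [of "{0}", rotated 2]) auto
  then have hi': "((\<lambda>y. y powr a * exp (-y)) has_integral Gamma (a + 1)) {0<..}"
    by (subst (asm) has_integral_restrict) auto
  \<comment> \<open>Nonnegativity is the bridge from the gauge integral, in which the Gamma integral
    is stated, to the Lebesgue integral.\<close>
  then have "(\<lambda>y. y powr a * exp (-y)) absolutely_integrable_on {0<..}"
    by (intro nonnegative_absolutely_integrable_1) auto
  then show i: "set_integrable lborel {0<..} (\<lambda>y. y powr a * exp (-y))"
    unfolding set_integrable_def by (subst (asm) integrable_completion) auto
  show "(LBINT y:{0<..}. y powr a * exp (-y)) = Gamma (a + 1)"
    using set_borel_integral_eq_integral(2)[OF i] hi' by (simp add: integral_unique)
qed

text \<open>Two exponents are allowed because a logarithm is dominated by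
  \<open>y powr p + y powr (-p)\<close>, one power for each end of the half-line.\<close>

lemma set_integrable_powr_exp_bound:
  fixes f :: "real \<Rightarrow> real" and a b C :: real
  assumes "f \<in> borel_measurable borel" "a > -1" "b > -1"
    and le: "\<And>y. y > 0 \<Longrightarrow> \<bar>f y\<bar> \<le> C * (y powr a + y powr b) * exp (-y)"
  shows "set_integrable lborel {0<..} f"
proof (rule set_integrable_bound)
  show "set_integrable lborel {0<..} (\<lambda>y. C * (y powr a * exp (-y) + y powr b * exp (-y)))"
    using assms by (intro set_integrable_mult_right set_integral_add set_integral_powr_exp)
  show "set_borel_measurable lborel {0<..} f"
    using assms by (simp add: set_borel_measurable_def)
  show "AE y in lborel. y \<in> {0<..} \<longrightarrow> norm (f y) \<le> norm (C * (y powr a * exp (-y) + y powr b * exp (-y)))"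
    using le by (intro AE_I2) (force simp: algebra_simps)
qed

text \<open>This is \<open>ln t \<le> t - 1\<close> at t = x / p, multiplied by p. It trades the
  damping factor of the kernel for an arbitrarily high power of y.\<close>

lemma exp_minus_le_powr:
  fixes p x :: real
  assumes "p > 0" "x > 0"
  shows "exp (-x) \<le> (p / x) powr p"
proof -
  have "p * ln (x / p) \<le> p * (x / p - 1)"
    using assms ln_le_minus_one[of "x / p"] by (intro mult_left_mono) auto
  also have "\<dots> \<le> x" using assms by (simp add: algebra_simps)
  finally have "-x \<le> p * ln (p / x)" using assms by (simp add: ln_div algebra_simps)
  then show ?thesis using assms by (simp add: powr_def mult.commute)
qed

lemma abs_ln_le_powr:
  fixes p x :: real
  assumes "p > 0" "x > 0"
  shows "\<bar>ln x\<bar> \<le> (x powr p + x powr (-p)) / p"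
proof -
  have "p * ln x \<le> x powr p" "- (p * ln x) \<le> x powr (-p)"
    using ln_le_minus_one[of "x powr p"] ln_le_minus_one[of "x powr (-p)"] assms
    by (simp_all add: ln_powr)
  moreover have "0 \<le> x powr p" "0 \<le> x powr (-p)" by simp_all
  ultimately have "\<bar>p * ln x\<bar> \<le> x powr p + x powr (-p)" by linarith
  then show ?thesis using assms(1) by (simp add: pos_le_divide_eq abs_mult mult.commute)
qed

text \<open>The left side is at most min 1 x, and \<open>x powr p\<close> lies above both branches.
  Exponents below 1 matter: with p = 1 the damping \<open>u powr (-2)\<close> met below would cost a
  factor that is not integrable at 0.\<close>

lemma one_minus_exp_le_powr:
  fixes p x :: real
  assumes "0 < p" "p \<le> 1" "x \<ge> 0"
  shows "0 \<le> 1 - exp (-x)" "1 - exp (-x) \<le> x powr p"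
proof -
  show "0 \<le> 1 - exp (-x)" using assms by simp
  show "1 - exp (-x) \<le> x powr p"
  proof (cases "x \<le> 1")
    case True
    have "1 - exp (-x) \<le> x" using exp_ge_add_one_self[of "-x"] by linarith
    also have "x \<le> x powr p"
      using powr_mono'[of p 1 x] True assms by simp
    finally show ?thesis .
  next
    case False
    then have "1 \<le> x powr p" using assms by (simp add: ge_one_powr_ge_zero)
    then show ?thesis using exp_gt_zero[of "-x"] by linarith
  qed
qed

subsection \<open>The integral as a function of its first argument\<close>

definition I1_kernel :: "real \<Rightarrow> real \<Rightarrow> real \<Rightarrow> real" where
  "I1_kernel \<mu> z y = y powr \<mu> * exp (-y) * exp (- z * y powr (- 1 / 2))"

lemma I1_eq: "I1 z \<mu> = (LBINT y:{0<..}. I1_kernel \<mu> z y)"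
  by (simp add: I1_def I1_kernel_def)

lemma I1_kernel_measurable [measurable]: "I1_kernel \<mu> z \<in> borel_measurable borel"
  unfolding I1_kernel_def by measurable

lemma I1_kernel_nonneg: "0 \<le> I1_kernel \<mu> z y"
  by (simp add: I1_kernel_def)

lemma I1_kernel_powr_mult: "y > 0 \<Longrightarrow> y powr a * I1_kernel \<mu> z y = I1_kernel (a + \<mu>) z y"
  by (simp add: I1_kernel_def powr_add)

lemma I1_kernel_bound:
  assumes "z > 0" "\<mu> < b"
  obtains C where "C > 0" "\<And>y. y > 0 \<Longrightarrow> I1_kernel \<mu> z y \<le> C * y powr b * exp (-y)"
proof
  \<comment> \<open>Chosen so that \<open>(y powr (1 / 2)) powr p\<close> raises the exponent from
    \<open>\<mu>\<close> to exactly \<open>b\<close>.\<close>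
  define p where "p = 2 * (b - \<mu>)"
  have p: "p > 0" and p2: "p / 2 = b - \<mu>" using assms by (simp_all add: p_def)
  show "(p / z) powr p > 0" using assms p by simp
  fix y :: real assume y: "y > 0"
  have "exp (- z * y powr (- 1 / 2)) \<le> (p / (z * y powr (- 1 / 2))) powr p"
    using exp_minus_le_powr[of p "z * y powr (- 1 / 2)"] y assms p by simp
  also have "p / (z * y powr (- 1 / 2)) = p / z * y powr (1 / 2)"
    using y by (simp add: powr_minus field_simps)
  also have "\<dots> powr p = (p / z) powr p * y powr (b - \<mu>)"
    using y assms p by (subst powr_mult) (simp_all add: powr_powr p2)
  finally have "y powr \<mu> * exp (- z * y powr (- 1 / 2)) \<le> y powr \<mu> * ((p / z) powr p * y powr (b - \<mu>))"
    by (intro mult_left_mono) auto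
  also have "\<dots> = (p / z) powr p * y powr b"
    by (simp add: powr_diff y)
  finally show "I1_kernel \<mu> z y \<le> (p / z) powr p * y powr b * exp (-y)"
    unfolding I1_kernel_def using mult_right_mono[of _ _ "exp (-y)"] by (simp add: mult_ac)
qed

lemma set_integrable_I1_kernel:
  assumes "z > 0"
  shows "set_integrable lborel {0<..} (I1_kernel \<mu> z)"
    and "set_integrable lborel {0<..} (\<lambda>y. ln y * I1_kernel \<mu> z y)"
proof -
  \<comment> \<open>Any \<open>b\<close> above \<open>\<mu>\<close> with \<open>b - 1 > -1\<close>
    would do: the bound on \<open>ln y\<close> costs one power in either direction.\<close>
  define b where "b = \<bar>\<mu>\<bar> + 2"
  obtain C where C: "C > 0" "\<And>y. y > 0 \<Longrightarrow> I1_kernel \<mu> z y \<le> C * y powr b * exp (-y)"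
    by (rule I1_kernel_bound[OF assms, of \<mu> b]) (simp add: b_def, rule that)
  show "set_integrable lborel {0<..} (I1_kernel \<mu> z)"
  proof (rule set_integrable_powr_exp_bound)
    fix y :: real assume "y > 0"
    then have "\<bar>I1_kernel \<mu> z y\<bar> \<le> C * y powr b * exp (-y)"
      using C(2)[of y] I1_kernel_nonneg[of \<mu> z y] by simp
    also have "\<dots> \<le> C * (y powr b + y powr b) * exp (-y)"
      using C(1) by (intro mult_right_mono mult_left_mono) auto
    finally show "\<bar>I1_kernel \<mu> z y\<bar> \<le> C * (y powr b + y powr b) * exp (-y)" .
  qed (auto simp: b_def)
  show "set_integrable lborel {0<..} (\<lambda>y. ln y * I1_kernel \<mu> z y)"
  proof (rule set_integrable_powr_exp_bound)
    fix y :: real assume y: "y > 0"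
    have "\<bar>ln y * I1_kernel \<mu> z y\<bar> \<le> ((y powr 1 + y powr (-1)) / 1) * (C * y powr b * exp (-y))"
      unfolding abs_mult using abs_ln_le_powr[of 1 y] y C I1_kernel_nonneg[of \<mu> z y]
      by (intro mult_mono) auto
    also have "\<dots> = C * (y powr (b + 1) + y powr (b - 1)) * exp (-y)"
      using y by (simp add: powr_add powr_diff powr_minus field_simps)
    finally show "\<bar>ln y * I1_kernel \<mu> z y\<bar> \<le> C * (y powr (b + 1) + y powr (b - 1)) * exp (-y)" .
  qed (auto simp: b_def)
qed

text \<open>
  The derivative is squeezed between two values of the candidate derivative, by convexity of
  \<open>z \<mapsto> exp (- z * y powr (- 1 / 2))\<close>.
\<close>

lemma I1_convex_ge:
  assumes "a > 0" "b > 0"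
  shows "I1 b \<mu> \<ge> I1 a \<mu> - (b - a) * I1 a (\<mu> - 1 / 2)"
proof -
  have "(LBINT y:{0<..}. I1_kernel \<mu> a y - (b - a) * I1_kernel (\<mu> - 1 / 2) a y)
         \<le> (LBINT y:{0<..}. I1_kernel \<mu> b y)"
  proof (rule set_integral_mono)
    fix y :: real assume "y \<in> {0<..}"
    then have y: "y > 0" by simp
    define g where "g = y powr (- 1 / 2)"
    have "exp (- b * g) = exp (- a * g) * exp (- ((b - a) * g))"
      by (simp add: exp_add [symmetric] algebra_simps)
    also have "\<dots> \<ge> exp (- a * g) * (1 - (b - a) * g)"
      using exp_ge_add_one_self[of "- ((b - a) * g)"] by (intro mult_left_mono) auto
    finally have "y powr \<mu> * exp (-y) * exp (- b * g) \<ge> y powr \<mu> * exp (-y) * (exp (- a * g) * (1 - (b - a) * g))"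
      by (intro mult_left_mono) auto
    moreover have "I1_kernel (\<mu> - 1 / 2) a y = g * I1_kernel \<mu> a y"
      using I1_kernel_powr_mult[OF y, of "- 1 / 2" \<mu> a] by (simp add: g_def)
    ultimately show "I1_kernel \<mu> a y - (b - a) * I1_kernel (\<mu> - 1 / 2) a y \<le> I1_kernel \<mu> b y"
      unfolding I1_kernel_def g_def [symmetric] by (simp add: algebra_simps)
  qed (use assms in \<open>auto intro!: set_integral_diff set_integrable_mult_right set_integrable_I1_kernel\<close>)
  then show ?thesis
    using assms by (simp add: I1_eq set_integral_diff set_integrable_I1_kernel)
qed

lemma I1_nonneg: "I1 z \<mu> \<ge> 0"
  unfolding I1_eq set_lebesgue_integral_def
  by (intro Bochner_Integration.integral_nonneg) (simp add: I1_kernel_nonneg)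

text \<open>The tangent at \<open>b\<close> lies below the graph at \<open>a\<close>, and its slope
  is nonpositive.\<close>

lemma I1_antimono:
  assumes "0 < a" "a \<le> b"
  shows "I1 b \<mu> \<le> I1 a \<mu>"
  using I1_convex_ge[of b a \<mu>] assms
    mult_nonpos_nonneg[of "a - b" "I1 b (\<mu> - 1 / 2)", OF _ I1_nonneg]
  by linarith

text \<open>The squeeze for the derivative closes only if the candidate derivative is continuous.
  Here the tangent inequalities at w and z give a Lipschitz bound; \<open>M\<close> bounds both
  slopes because w and z exceed z / 2 and the slopes shrink as the argument grows.\<close>

lemma isCont_I1:
  assumes "z > 0"
  shows "isCont (\<lambda>z. I1 z \<mu>) z"
proof -
  define M where "M = I1 (z / 2) (\<mu> - 1 / 2)"
  have "eventually (\<lambda>w. \<bar>I1 w \<mu> - I1 z \<mu>\<bar> \<le> \<bar>w - z\<bar> * M) (at z)"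
  proof -
    have "eventually (\<lambda>w. w > z / 2) (at z)"
      using assms order_tendstoD(1)[OF tendsto_ident_at, of "z / 2" z] by simp
    then show ?thesis
    proof eventually_elim
      case (elim w)
      have le: "I1 w (\<mu> - 1 / 2) \<le> M" "I1 z (\<mu> - 1 / 2) \<le> M"
        using elim assms by (auto simp: M_def intro!: I1_antimono)
      have ge: "I1 w (\<mu> - 1 / 2) \<ge> 0" "I1 z (\<mu> - 1 / 2) \<ge> 0" by (simp_all add: I1_nonneg)
      show ?case
      proof (cases "w \<le> z")
        case True
        have "I1 w \<mu> \<ge> I1 z \<mu>" using True elim assms by (intro I1_antimono) auto
        moreover have "I1 z \<mu> \<ge> I1 w \<mu> - (z - w) * I1 w (\<mu> - 1 / 2)"
          using elim assms by (intro I1_convex_ge) auto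
        moreover have "(z - w) * I1 w (\<mu> - 1 / 2) \<le> (z - w) * M"
          using True le by (intro mult_left_mono) auto
        ultimately show ?thesis using True by simp
      next
        case False
        have "I1 w \<mu> \<le> I1 z \<mu>" using False elim assms by (intro I1_antimono) auto
        moreover have "I1 w \<mu> \<ge> I1 z \<mu> - (w - z) * I1 z (\<mu> - 1 / 2)"
          using elim assms by (intro I1_convex_ge) auto
        moreover have "(w - z) * I1 z (\<mu> - 1 / 2) \<le> (w - z) * M"
          using False le by (intro mult_left_mono) auto
        ultimately show ?thesis using False by linarith
      qed
    qed
  qed
  moreover have "((\<lambda>w. \<bar>w - z\<bar> * M) \<longlongrightarrow> \<bar>z - z\<bar> * M) (at z)"
    by (intro tendsto_intros)
  ultimately have "((\<lambda>w. I1 w \<mu> - I1 z \<mu>) \<longlongrightarrow> 0) (at z)"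
    by (intro Lim_null_comparison[of "\<lambda>w. I1 w \<mu> - I1 z \<mu>" "\<lambda>w. \<bar>w - z\<bar> * M"]) auto
  then show ?thesis unfolding isCont_def by (simp add: LIM_zero_iff)
qed

lemma has_real_derivative_I1:
  assumes "z > 0"
  shows "((\<lambda>z. I1 z \<mu>) has_real_derivative - I1 z (\<mu> - 1 / 2)) (at z)"
proof -
  define d where "d = (\<lambda>z. - I1 z (\<mu> - 1 / 2))"
  have pos: "eventually (\<lambda>w. w > 0 \<and> w \<noteq> z) (at z)"
    using assms order_tendstoD(1)[OF tendsto_ident_at, of 0 z]
    by (auto simp: eventually_conj_iff eventually_neq_at_within)
  have le: "\<bar>(I1 w \<mu> - I1 z \<mu>) / (w - z) - d z\<bar> \<le> \<bar>d w - d z\<bar>" if "w > 0" "w \<noteq> z" for w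
  proof -
    have 1: "I1 w \<mu> - I1 z \<mu> \<ge> (w - z) * d z" "I1 w \<mu> - I1 z \<mu> \<le> (w - z) * d w"
      using I1_convex_ge[of z w \<mu>] I1_convex_ge[of w z \<mu>] that assms
      by (simp_all add: d_def algebra_simps)
    show ?thesis
    proof (cases "w > z")
      case True
      then have "d z \<le> (I1 w \<mu> - I1 z \<mu>) / (w - z)" "(I1 w \<mu> - I1 z \<mu>) / (w - z) \<le> d w"
        using 1 by (simp_all add: field_simps)
      then show ?thesis by linarith
    next
      case False
      then have "w - z < 0" using that by simp
      then have "d z \<ge> (I1 w \<mu> - I1 z \<mu>) / (w - z)" "(I1 w \<mu> - I1 z \<mu>) / (w - z) \<ge> d w"
        using 1 by (simp_all add: neg_le_divide_eq neg_divide_le_eq mult.commute)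
      then show ?thesis by linarith
    qed
  qed
  have "(d \<longlongrightarrow> d z) (at z)"
    using isCont_I1[OF assms, of "\<mu> - 1 / 2"] unfolding d_def isCont_def
    by (rule tendsto_minus)
  then have "((\<lambda>w. \<bar>d w - d z\<bar>) \<longlongrightarrow> \<bar>d z - d z\<bar>) (at z)"
    by (intro tendsto_intros)
  then have "((\<lambda>w. (I1 w \<mu> - I1 z \<mu>) / (w - z) - d z) \<longlongrightarrow> 0) (at z)"
    by (intro Lim_null_comparison[of "\<lambda>w. (I1 w \<mu> - I1 z \<mu>) / (w - z) - d z" "\<lambda>w. \<bar>d w - d z\<bar>"])
      (rule eventually_mono[OF pos], use le in auto)
  then have "((\<lambda>w. (I1 w \<mu> - I1 z \<mu>) / (w - z)) \<longlongrightarrow> d z) (at z)"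
    by (rule LIM_zero_cancel)
  then show ?thesis
    unfolding has_field_derivative_iff by (simp only: d_def)
qed

subsection \<open>Behaviour at the origin\<close>

text \<open>The bound 1 - e^(-x) \<le> x^(c/q) at x = w u^(-q) splits into w^(c/q) and u^(-c), so
  \<open>c\<close> is the loss of exponent at 0 that \<open>\<phi>\<close> must tolerate. A rate is
  kept, and not only a limit, because one such difference is later multiplied by a logarithm. The
  exponent \<open>q\<close> is 1/2 for the original kernel and 2 after the substitution.\<close>

lemma damped_integral_diff_bound:
  fixes \<phi> :: "real \<Rightarrow> real"
  assumes [measurable]: "\<phi> \<in> borel_measurable borel"
    and le: "\<And>u. u > 0 \<Longrightarrow> \<bar>\<phi> u\<bar> \<le> C * (u powr a + u powr b) * exp (-u)"
    and c: "0 < c" "c \<le> q" "a - c > -1" "b - c > -1"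
  obtains M where "\<And>w. w > 0 \<Longrightarrow>
    \<bar>(LBINT u:{0<..}. \<phi> u * exp (- w * u powr (-q))) - (LBINT u:{0<..}. \<phi> u)\<bar> \<le> M * w powr (c / q)"
proof
  define p where "p = c / q"
  have p: "0 < p" "p \<le> 1" "q * p = c" using c by (auto simp: p_def)
  have int1: "set_integrable lborel {0<..} \<phi>"
    by (rule set_integrable_powr_exp_bound[of _ a b C]) (use le c in auto)
  have int2: "set_integrable lborel {0<..} (\<lambda>u. \<bar>\<phi> u\<bar> * u powr (-c))"
  proof (rule set_integrable_powr_exp_bound[of _ "a - c" "b - c" C])
    fix u :: real assume u: "u > 0"
    have "\<bar>\<bar>\<phi> u\<bar> * u powr (-c)\<bar> \<le> (C * (u powr a + u powr b) * exp (-u)) * u powr (-c)"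
      using le[OF u] by (simp add: abs_mult mult_right_mono)
    also have "\<dots> = C * (u powr (a - c) + u powr (b - c)) * exp (-u)"
      by (simp add: powr_diff powr_minus divide_inverse algebra_simps)
    finally show "\<bar>\<bar>\<phi> u\<bar> * u powr (-c)\<bar> \<le> C * (u powr (a - c) + u powr (b - c)) * exp (-u)" .
  qed (use c in auto)
  fix w :: real assume w: "w > 0"
  have int3: "set_integrable lborel {0<..} (\<lambda>u. \<phi> u * exp (- w * u powr (-q)))"
  proof (rule set_integrable_bound[OF int1])
    show "AE u in lborel. u \<in> {0<..} \<longrightarrow> norm (\<phi> u * exp (- w * u powr (-q))) \<le> norm (\<phi> u)"
      using w by (intro AE_I2) (simp add: abs_mult mult_left_le)
  qed (simp add: set_borel_measurable_def)
  have bd: "norm (\<phi> u * exp (- w * u powr (-q)) - \<phi> u) \<le> w powr p * (\<bar>\<phi> u\<bar> * u powr (-c))"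
    if u: "u > 0" for u
  proof -
    have "norm (\<phi> u * exp (- w * u powr (-q)) - \<phi> u) = \<bar>\<phi> u\<bar> * \<bar>1 - exp (- (w * u powr (-q)))\<bar>"
      unfolding real_norm_def abs_mult [symmetric] by (simp add: algebra_simps abs_minus_commute)
    also have "\<dots> \<le> \<bar>\<phi> u\<bar> * (w * u powr (-q)) powr p"
      using one_minus_exp_le_powr[of p "w * u powr (-q)"] p w u by (intro mult_left_mono) auto
    also have "(w * u powr (-q)) powr p = w powr p * u powr (-c)"
      using w u p(3) by (simp add: powr_mult powr_powr)
    finally show ?thesis by (simp add: mult_ac)
  qed
  have "norm (LBINT u:{0<..}. \<phi> u * exp (- w * u powr (-q)) - \<phi> u)
        \<le> (LBINT u:{0<..}. norm (\<phi> u * exp (- w * u powr (-q)) - \<phi> u))"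
    by (intro set_integral_norm_bound set_integral_diff int1 int3)
  also have "\<dots> \<le> (LBINT u:{0<..}. w powr p * (\<bar>\<phi> u\<bar> * u powr (-c)))"
    using bd by (intro set_integral_mono set_integrable_norm set_integral_diff int1 int3
      set_integrable_mult_right int2) auto
  finally show "\<bar>(LBINT u:{0<..}. \<phi> u * exp (- w * u powr (-q))) - (LBINT u:{0<..}. \<phi> u)\<bar>
    \<le> (LBINT u:{0<..}. \<bar>\<phi> u\<bar> * u powr (-c)) * w powr (c / q)"
    using set_integral_diff(2)[OF int3 int1] by (simp add: p_def mult.commute)
qed

lemma damped_integral_tendsto:
  fixes \<phi> :: "real \<Rightarrow> real"
  assumes "\<phi> \<in> borel_measurable borel"
    and "\<And>u. u > 0 \<Longrightarrow> \<bar>\<phi> u\<bar> \<le> C * (u powr a + u powr b) * exp (-u)"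
    and c: "0 < c" "c \<le> q" "a - c > -1" "b - c > -1"
  shows "((\<lambda>w. LBINT u:{0<..}. \<phi> u * exp (- w * u powr (-q))) \<longlongrightarrow> (LBINT u:{0<..}. \<phi> u)) (at_right 0)"
proof -
  obtain M where M: "\<And>w. w > 0 \<Longrightarrow>
    \<bar>(LBINT u:{0<..}. \<phi> u * exp (- w * u powr (-q))) - (LBINT u:{0<..}. \<phi> u)\<bar> \<le> M * w powr (c / q)"
    by (rule damped_integral_diff_bound[OF assms]) (assumption, rule that)
  have "c / q > 0" using c by simp
  then have lim: "((\<lambda>w. M * w powr (c / q)) \<longlongrightarrow> 0) (at_right 0)"
    by real_asymp
  have "eventually (\<lambda>w::real. w > 0) (at_right 0)" by (simp add: eventually_at_right_less)
  then have "eventually (\<lambda>w. norm ((LBINT u:{0<..}. \<phi> u * exp (- w * u powr (-q))) - (LBINT u:{0<..}. \<phi> u))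
      \<le> M * w powr (c / q)) (at_right 0)"
    by eventually_elim (use M in simp)
  from Lim_null_comparison[OF this lim] show ?thesis by (rule LIM_zero_cancel)
qed

lemma tendsto_I1_at_right_0:
  assumes "\<mu> \<ge> - 1 / 2"
  shows "((\<lambda>z. I1 z \<mu>) \<longlongrightarrow> Gamma (\<mu> + 1)) (at_right 0)"
  \<comment> \<open>With c = 1/4 the lowered exponent \<open>\<mu> - c\<close> is at least
    -3/4.\<close>
  using damped_integral_tendsto[of "\<lambda>u. u powr \<mu> * exp (-u)" 1 \<mu> \<mu> "1 / 4" "1 / 2"] assms
  by (simp add: I1_def set_integral_powr_exp)

lemma abs_ln_exp_bound:
  fixes u :: real
  assumes "u > 0"
  shows "\<bar>ln u * exp (-u)\<bar> \<le> 4 * (u powr (1 / 4) + u powr (- 1 / 4)) * exp (-u)"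
  using abs_ln_le_powr[of "1 / 4" u] assms by (simp add: abs_mult mult_ac)

lemma set_integral_exp_minus:
  "set_integrable lborel {0<..} (\<lambda>u::real. exp (-u))" "(LBINT u:{0<..}. exp (-u)) = (1::real)"
proof -
  show "set_integrable lborel {0<..} (\<lambda>u::real. exp (-u))"
    by (rule set_integrable_powr_exp_bound[of _ 0 0 1]) auto
  have "(LBINT u:{0<..}. exp (-u)) = (LBINT u:{0<..}. u powr 0 * exp (-u) :: real)"
    by (intro set_lebesgue_integral_cong) auto
  also have "\<dots> = 1" using set_integral_powr_exp(2)[of 0] by simp
  finally show "(LBINT u:{0<..}. exp (-u)) = (1::real)" .
qed

text \<open>
  \<open>u powr s \<ge> 1 + s * ln u\<close> for both signs of \<open>s\<close>, so \<open>Gamma (1 + s) - 1 - s * L\<close>, with \<open>L\<close> the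
  integral below, is minimal at \<open>s = 0\<close>. This gives \<open>L = Digamma 1\<close> without differentiating under the
  integral sign.
\<close>

lemma integral_ln_exp: "(LBINT u:{0<..}. ln u * exp (-u)) = - (euler_mascheroni :: real)"
proof -
  define L :: real where "L = (LBINT u:{0<..}. ln u * exp (-u))"
  have intL: "set_integrable lborel {0<..} (\<lambda>u::real. ln u * exp (-u))"
    by (rule set_integrable_powr_exp_bound[of _ "1 / 4" "- 1 / 4" 4]) (use abs_ln_exp_bound in auto)
  note int0 = set_integral_exp_minus
  define f where "f = (\<lambda>s. Gamma (1 + s) - 1 - s * L)"
  have "f 0 \<le> f s" if "\<bar>0 - s\<bar> < 1" for s
  proof -
    have "(LBINT u:{0<..}. exp (-u) + s * (ln u * exp (-u))) \<le> (LBINT u:{0<..}. u powr s * exp (-u))"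
    proof (rule set_integral_mono)
      fix u :: real assume "u \<in> {0<..}"
      then have "u powr s \<ge> 1 + s * ln u"
        using exp_ge_add_one_self[of "s * ln u"] by (simp add: powr_def)
      then have "(1 + s * ln u) * exp (-u) \<le> u powr s * exp (-u)"
        by (intro mult_right_mono) auto
      then show "exp (-u) + s * (ln u * exp (-u)) \<le> u powr s * exp (-u)"
        by (simp add: algebra_simps)
    qed (use that in \<open>auto intro!: set_integral_add set_integrable_mult_right intL int0 set_integral_powr_exp\<close>)
    also have "(LBINT u:{0<..}. exp (-u) + s * (ln u * exp (-u))) = 1 + s * L"
      using intL int0 by (subst set_integral_add) (auto simp: L_def)
    also have "(LBINT u:{0<..}. u powr s * exp (-u)) = Gamma (1 + s)"
      using that by (simp add: set_integral_powr_exp add.commute)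
    finally show ?thesis by (simp add: f_def)
  qed
  moreover have "(f has_real_derivative (Gamma 1 * Digamma 1 - L)) (at 0)"
    unfolding f_def by (auto intro!: derivative_eq_intros)
  ultimately have "Gamma 1 * Digamma 1 - L = 0"
    by (intro DERIV_local_min[of f _ 0 1]) auto
  then show ?thesis by (simp add: L_def)
qed

section \<open>Integration by parts and the logarithmic singularity of
  \<open>I1 z (-1)\<close>\<close>

lemma set_integral_deriv_eq_0:
  fixes f F :: "real \<Rightarrow> real"
  assumes F: "\<And>x. x > 0 \<Longrightarrow> (F has_real_derivative f x) (at x)"
    and f: "\<And>x. x > 0 \<Longrightarrow> isCont f x"
    and int: "set_integrable lborel {0<..} f"
    and lim: "(F \<longlongrightarrow> 0) (at_right 0)" "(F \<longlongrightarrow> 0) at_top"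
  shows "(LBINT x:{0<..}. f x) = 0"
proof -
  have ei: "einterval 0 \<infinity> = {0<..}" by (auto simp: einterval_def zero_ereal_def)
  have "(LBINT x=0..\<infinity>. f x) = 0 - 0"
  proof (rule interval_integral_FTC_integrable)
    show "((F \<circ> real_of_ereal) \<longlongrightarrow> 0) (at_right 0)"
      using lim(1) unfolding zero_ereal_def ereal_tendsto_simps .
    show "((F \<circ> real_of_ereal) \<longlongrightarrow> 0) (at_left \<infinity>)"
      using lim(2) unfolding ereal_tendsto_simps .
    show "set_integrable lborel (einterval 0 \<infinity>) f" using int by (simp add: ei)
  qed (use F f in \<open>auto simp: zero_ereal_def has_real_derivative_iff_has_vector_derivative [symmetric]\<close>)
  then show ?thesis by (simp add: interval_lebesgue_integral_def ei)
qed

lemma has_real_derivative_I1_kernel: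
  assumes "y > 0"
  shows "(I1_kernel 0 z has_real_derivative (z / 2 * I1_kernel (- 3 / 2) z y - I1_kernel 0 z y)) (at y)"
proof -
  have eq: "- 1 / 2 - 1 = (- 3 / 2 :: real)" by simp
  have "((\<lambda>y. exp (-y) * exp (- z * y powr (- 1 / 2))) has_real_derivative
      exp (-y) * (exp (- z * y powr (- 1 / 2)) * (- z * (- 1 / 2 * y powr (- 1 / 2 - 1))))
      + (- exp (-y)) * exp (- z * y powr (- 1 / 2))) (at y)"
    using assms by (auto intro!: derivative_eq_intros)
  then have "((\<lambda>y. exp (-y) * exp (- z * y powr (- 1 / 2))) has_real_derivative
      (z / 2 * I1_kernel (- 3 / 2) z y - I1_kernel 0 z y)) (at y)"
    unfolding I1_kernel_def eq using assms by (simp add: algebra_simps)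
  \<comment> \<open>\<open>y powr 0\<close> is 1 only away from 0, so the factor is restored on the
    open half-line.\<close>
  then show ?thesis
    by (rule has_field_derivative_transform_within_open[of _ _ _ "{0<..}"])
      (use assms in \<open>auto simp: I1_kernel_def\<close>)
qed

lemma isCont_I1_kernel: "y > 0 \<Longrightarrow> isCont (I1_kernel \<mu> z) y"
  unfolding I1_kernel_def [abs_def] by (intro continuous_intros) auto

text \<open>The derivative of the kernel with exponent 0 integrates to 0. As
  \<open>I1 z (- 3 / 2)\<close> is minus the third derivative of \<open>I1 z 0\<close>, this is the
  differential equation.\<close>

lemma I1_0_eq:
  assumes "z > 0"
  shows "I1 z 0 = z / 2 * I1 z (- 3 / 2)"
proof -
  have "(LBINT y:{0<..}. z / 2 * I1_kernel (- 3 / 2) z y - I1_kernel 0 z y) = 0"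
  proof (rule set_integral_deriv_eq_0[OF has_real_derivative_I1_kernel])
    show "(I1_kernel 0 z \<longlongrightarrow> 0) (at_right 0)"
      unfolding I1_kernel_def [abs_def] using assms by real_asymp
    show "(I1_kernel 0 z \<longlongrightarrow> 0) at_top"
      unfolding I1_kernel_def [abs_def] using assms by real_asymp
  qed (use assms in \<open>auto intro!: continuous_intros isCont_I1_kernel set_integral_diff
         set_integrable_mult_right set_integrable_I1_kernel\<close>)
  also have "(LBINT y:{0<..}. z / 2 * I1_kernel (- 3 / 2) z y - I1_kernel 0 z y)
      = z / 2 * I1 z (- 3 / 2) - I1 z 0"
    unfolding I1_eq using set_integrable_I1_kernel(1)[OF assms]
    by (subst set_integral_diff(2)) simp_all
  finally show ?thesis by simp
qed

text \<open>The factor 1/y is integrated to \<open>ln y\<close>; the boundary terms vanish, at 0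
  thanks to the damping factor.\<close>

lemma I1_minus_1_eq:
  assumes "z > 0"
  shows "I1 z (-1) = (LBINT y:{0<..}. ln y * I1_kernel 0 z y)
                   - z / 2 * (LBINT y:{0<..}. ln y * I1_kernel (- 3 / 2) z y)"
proof -
  let ?k = "\<lambda>\<mu> y. I1_kernel \<mu> z y"
  have int: "set_integrable lborel {0<..} (\<lambda>y. ?k (-1) y - ln y * ?k 0 y)"
    "set_integrable lborel {0<..} (\<lambda>y. z / 2 * (ln y * ?k (- 3 / 2) y))"
    by (rule set_integral_diff(1) set_integrable_mult_right set_integrable_I1_kernel assms)+
  have "(LBINT y:{0<..}. (?k (-1) y - ln y * ?k 0 y) + z / 2 * (ln y * ?k (- 3 / 2) y)) = 0"
  proof (rule set_integral_deriv_eq_0)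
    fix y :: real assume y: "y > 0"
    have "((\<lambda>y. ln y * ?k 0 y) has_real_derivative
        inverse y * ?k 0 y + (z / 2 * ?k (- 3 / 2) y - ?k 0 y) * ln y) (at y)"
      using y by (intro DERIV_mult DERIV_ln has_real_derivative_I1_kernel)
    moreover have "inverse y * ?k 0 y = ?k (-1) y"
      using y I1_kernel_powr_mult[OF y, of "-1" 0 z] by (simp add: powr_minus)
    ultimately show "((\<lambda>y. ln y * ?k 0 y) has_real_derivative
        (?k (-1) y - ln y * ?k 0 y) + z / 2 * (ln y * ?k (- 3 / 2) y)) (at y)"
      by (simp add: algebra_simps)
  next
    show "((\<lambda>y. ln y * ?k 0 y) \<longlongrightarrow> 0) (at_right 0)"
      unfolding I1_kernel_def using assms by real_asymp
    show "((\<lambda>y. ln y * ?k 0 y) \<longlongrightarrow> 0) at_top"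
      unfolding I1_kernel_def using assms by real_asymp
    show "set_integrable lborel {0<..} (\<lambda>y. (?k (-1) y - ln y * ?k 0 y) + z / 2 * (ln y * ?k (- 3 / 2) y))"
      by (intro set_integral_add int)
  qed (auto intro!: continuous_intros isCont_I1_kernel)
  also have "(LBINT y:{0<..}. (?k (-1) y - ln y * ?k 0 y) + z / 2 * (ln y * ?k (- 3 / 2) y))
      = (LBINT y:{0<..}. ?k (-1) y - ln y * ?k 0 y) + z / 2 * (LBINT y:{0<..}. ln y * ?k (- 3 / 2) y)"
    using int by (subst set_integral_add) auto
  also have "(LBINT y:{0<..}. ?k (-1) y - ln y * ?k 0 y) = I1 z (-1) - (LBINT y:{0<..}. ln y * ?k 0 y)"
    unfolding I1_eq by (rule set_integral_diff(2)) (rule set_integrable_I1_kernel assms)+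
  finally show ?thesis by simp
qed

text \<open>Setting y = z^2 / u^2 exchanges the two exponentials: e^(-z/sqrt y) becomes e^(-u), and
  e^(-y) becomes a damping that disappears as z tends to 0. The Jacobian, the prefactor z / 2 and
  y^(-3/2) multiply to 1, and ln y = 2 ln z - 2 ln u releases the logarithm of z.\<close>

lemma integral_ln_I1_kernel_subst:
  assumes z: "z > 0"
  shows "z / 2 * (LBINT y:{0<..}. ln y * I1_kernel (- 3 / 2) z y)
    = 2 * ln z * (LBINT u:{0<..}. exp (-u) * exp (- z\<^sup>2 * u powr (-2)))
      - 2 * (LBINT u:{0<..}. ln u * exp (-u) * exp (- z\<^sup>2 * u powr (-2)))"
proof -
  define f where "f = (\<lambda>y. z / 2 * (ln y * I1_kernel (- 3 / 2) z y))"
  define g where "g = (\<lambda>u::real. z\<^sup>2 * u powr (-2))"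
  define g' where "g' = (\<lambda>u::real. - 2 * z\<^sup>2 * u powr (-3))"
  define E where "E = (\<lambda>u::real. exp (-u) * exp (- z\<^sup>2 * u powr (-2)))"
  have intf: "set_integrable lborel {0<..} f"
    unfolding f_def by (rule set_integrable_mult_right set_integrable_I1_kernel z)+
  \<comment> \<open>The change of variables is carried out for absolutely integrable functions; the
    result returns to \<open>lborel\<close> at the end.\<close>
  have intf': "f absolutely_integrable_on {0<..}"
    using intf unfolding set_integrable_def
    by (subst integrable_completion) (auto dest: borel_measurable_integrable)
  have g_image: "g ` {0<..} = {0<..}"
  proof (intro equalityI subsetI)
    fix y :: real assume y: "y \<in> {0<..}"
    have "(z * y powr (- 1 / 2)) powr (-2) = z powr (-2) * y powr 1"
      using z y by (simp add: powr_mult powr_powr)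
    then have "g (z * y powr (- 1 / 2)) = y"
      using z y by (simp add: g_def powr_minus powr_numeral)
    moreover have "z * y powr (- 1 / 2) \<in> {0<..}" using z y by simp
    ultimately show "y \<in> g ` {0<..}" by (metis image_eqI)
  qed (use z in \<open>auto simp: g_def\<close>)
  have "inj_on g {0<..}"
    using z by (auto simp: inj_on_def g_def powr_minus powr_numeral)
  moreover have "(g has_field_derivative g' u) (at u within {0<..})" if "u \<in> {0<..}" for u
    using that unfolding g_def g'_def by (auto intro!: derivative_eq_intros)
  ultimately have cov: "(\<lambda>u. \<bar>g' u\<bar> * f (g u)) absolutely_integrable_on {0<..} \<and>
      integral {0<..} (\<lambda>u. \<bar>g' u\<bar> * f (g u)) = integral {0<..} f"
    using has_absolute_integral_change_of_variables_1'[of "{0<..}" g g' f "integral {0<..} f"] intf' g_image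
    by simp
  have eq: "\<bar>g' u\<bar> * f (g u) = 2 * ln z * E u - 2 * (ln u * E u)" if u: "u > 0" for u
  proof -
    have gu: "g u = (z / u)\<^sup>2"
      using u by (simp add: g_def powr_minus power_divide divide_inverse[of "z\<^sup>2"])
    have 1: "g u powr (- 1 / 2) = u / z"
      using z u unfolding gu by (simp add: powr_minus powr_half_sqrt)
    have "g u powr (- 3 / 2) = (g u powr (- 1 / 2)) powr 3"
      by (simp add: powr_powr)
    also have "\<dots> = (g u powr (- 1 / 2)) ^ 3"
      using z u by (intro powr_numeral) (simp add: gu)
    finally have 2: "g u powr (- 3 / 2) = (u / z) ^ 3" by (simp only: 1)
    have 3: "ln (g u) = 2 * ln z - 2 * ln u"
      using z u by (simp add: g_def ln_mult ln_powr ln_realpow)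
    have 4: "\<bar>g' u\<bar> = 2 * z\<^sup>2 / u ^ 3"
      using z u by (simp add: g'_def powr_minus powr_numeral divide_inverse abs_mult)
    have "f (g u) = z / 2 * ((2 * ln z - 2 * ln u) * ((u / z) ^ 3 * exp (- g u) * exp (-u)))"
      unfolding f_def I1_kernel_def 1 2 3 using z by simp
    then have "\<bar>g' u\<bar> * f (g u) = (2 * z\<^sup>2 / u ^ 3 * (z / 2) * (u / z) ^ 3)
        * ((2 * ln z - 2 * ln u) * (exp (- g u) * exp (-u)))"
      unfolding 4 by (simp only: mult_ac)
    also have "2 * z\<^sup>2 / u ^ 3 * (z / 2) * (u / z) ^ 3 = 1"
      using z u by (simp add: field_simps power2_eq_square power3_eq_cube)
    finally have "\<bar>g' u\<bar> * f (g u) = (2 * ln z - 2 * ln u) * (exp (- g u) * exp (-u))"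
      by simp
    then show ?thesis by (simp add: E_def g_def algebra_simps)
  qed
  have E_le: "\<bar>E u\<bar> \<le> exp (-u)" for u
    by (simp add: E_def abs_mult)
  have intE: "set_integrable lborel {0<..} E"
  proof (rule set_integrable_powr_exp_bound[of _ 0 0 1])
    fix u :: real assume "u > 0"
    then show "\<bar>E u\<bar> \<le> 1 * (u powr 0 + u powr 0) * exp (-u)"
      using E_le[of u] exp_gt_zero[of "-u"] by simp
  qed (auto simp: E_def)
  have intlnE: "set_integrable lborel {0<..} (\<lambda>u. ln u * E u)"
  proof (rule set_integrable_powr_exp_bound[of _ "1 / 4" "- 1 / 4" 4])
    fix u :: real assume "u > 0"
    have "\<bar>ln u * E u\<bar> \<le> \<bar>ln u * exp (-u)\<bar>"
      unfolding abs_mult using E_le[of u] by (intro mult_left_mono) auto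
    also note abs_ln_exp_bound[OF \<open>u > 0\<close>]
    finally show "\<bar>ln u * E u\<bar> \<le> 4 * (u powr (1 / 4) + u powr (- 1 / 4)) * exp (-u)" .
  qed (auto simp: E_def)
  have "z / 2 * (LBINT y:{0<..}. ln y * I1_kernel (- 3 / 2) z y) = (LBINT y:{0<..}. f y)"
    unfolding f_def by simp
  also have "\<dots> = integral {0<..} f" by (rule set_borel_integral_eq_integral(2)[OF intf])
  also have "\<dots> = integral {0<..} (\<lambda>u. 2 * ln z * E u - 2 * (ln u * E u))"
    using cov eq by (metis (no_types, lifting) integral_cong greaterThan_iff)
  also have "\<dots> = (LBINT u:{0<..}. 2 * ln z * E u - 2 * (ln u * E u))"
    by (rule set_borel_integral_eq_integral(2)[symmetric])
      (rule set_integral_diff(1) set_integrable_mult_right intE intlnE)+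
  also have "\<dots> = 2 * ln z * (LBINT u:{0<..}. E u) - 2 * (LBINT u:{0<..}. ln u * E u)"
    by (subst set_integral_diff(2)) (rule set_integrable_mult_right intE intlnE | simp)+
  finally show ?thesis by (simp add: E_def mult.assoc)
qed

lemma tendsto_I1_minus_1:
  "((\<lambda>z. I1 z (-1) + 2 * ln z) \<longlongrightarrow> - 3 * euler_mascheroni) (at_right 0)"
proof -
  define A where "A = (\<lambda>z::real. LBINT y:{0<..}. ln y * exp (-y) * exp (- z * y powr (- (1 / 2))) :: real)"
  define B where "B = (\<lambda>w::real. LBINT u:{0<..}. ln u * exp (-u) * exp (- w * u powr (- 2)) :: real)"
  define P where "P = (\<lambda>w::real. LBINT u:{0<..}. exp (-u) * exp (- w * u powr (- 2)))"
  have A: "(A \<longlongrightarrow> - euler_mascheroni) (at_right 0)"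
    unfolding A_def integral_ln_exp [symmetric]
    by (rule damped_integral_tendsto[of _ 4 "1 / 4" "- 1 / 4" "1 / 4"]) (use abs_ln_exp_bound in auto)
  have B: "(B \<longlongrightarrow> - euler_mascheroni) (at_right 0)"
    unfolding B_def integral_ln_exp [symmetric]
    by (rule damped_integral_tendsto[of _ 4 "1 / 4" "- 1 / 4" "1 / 4"]) (use abs_ln_exp_bound in auto)
  have sq: "filterlim (\<lambda>z::real. z\<^sup>2) (at_right 0) (at_right 0)" by real_asymp
  \<comment> \<open>The rate w^(1/4) at w = z^2 is sqrt z, which outweighs the factor
    \<open>ln z\<close> multiplying \<open>1 - P (z\<^sup>2)\<close>.\<close>
  obtain M where M: "\<And>w. w > 0 \<Longrightarrow> \<bar>P w - (LBINT u:{0<..}. exp (-u))\<bar> \<le> M * w powr (1 / 2 / 2)"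
    unfolding P_def
    by (rule damped_integral_diff_bound[of "\<lambda>u. exp (-u)" 1 0 0 "1 / 2" 2]) (auto intro: that)
  have "((\<lambda>z. 2 * ln z * (1 - P (z\<^sup>2))) \<longlongrightarrow> 0) (at_right 0)"
  proof (rule Lim_null_comparison)
    show "eventually (\<lambda>z. norm (2 * ln z * (1 - P (z\<^sup>2))) \<le> 2 * \<bar>ln z\<bar> * (M * (z\<^sup>2) powr (1 / 4))) (at_right 0)"
      using eventually_at_right_less[of "0::real"]
    proof eventually_elim
      case (elim z)
      have "\<bar>1 - P (z\<^sup>2)\<bar> \<le> M * (z\<^sup>2) powr (1 / 4)"
        using M[of "z\<^sup>2"] elim by (simp add: set_integral_exp_minus abs_minus_commute)
      then show ?case by (simp add: abs_mult mult_left_mono)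
    qed
    show "((\<lambda>z::real. 2 * \<bar>ln z\<bar> * (M * (z\<^sup>2) powr (1 / 4))) \<longlongrightarrow> 0) (at_right 0)"
      by real_asymp
  qed
  then have "((\<lambda>z. A z + 2 * ln z * (1 - P (z\<^sup>2)) + 2 * B (z\<^sup>2)) \<longlongrightarrow>
      - euler_mascheroni + 0 + 2 * (- euler_mascheroni)) (at_right 0)"
    by (intro tendsto_intros A filterlim_compose[OF B sq])
  moreover have "eventually (\<lambda>z. A z + 2 * ln z * (1 - P (z\<^sup>2)) + 2 * B (z\<^sup>2) = I1 z (-1) + 2 * ln z) (at_right 0)"
    using eventually_at_right_less[of "0::real"]
  proof eventually_elim
    case (elim z)
    have "A z = (LBINT y:{0<..}. ln y * I1_kernel 0 z y)"
      unfolding A_def I1_kernel_def by (intro set_lebesgue_integral_cong) auto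
    then show ?case
      unfolding I1_minus_1_eq[OF elim] integral_ln_I1_kernel_subst[OF elim]
      by (simp add: P_def B_def algebra_simps)
  qed
  ultimately have "((\<lambda>z. I1 z (-1) + 2 * ln z) \<longlongrightarrow>
      - euler_mascheroni + 0 + 2 * (- euler_mascheroni)) (at_right 0)"
    by (rule Lim_transform_eventually)
  then show ?thesis by simp
qed

subsection \<open>Power series with a logarithm\<close>

text \<open>
  Subtracting \<open>\<beta> k * harm k\<close> makes differentiation a shift of both coefficient sequences:
  the derivative of \<open>z ^ k / fact k * (ln z - harm k)\<close> is the same expression with \<open>k - 1\<close>.
\<close>

definition log_series :: "(nat \<Rightarrow> real) \<Rightarrow> (nat \<Rightarrow> real) \<Rightarrow> real \<Rightarrow> real" where
  "log_series \<alpha> \<beta> z =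
     (\<Sum>k. (\<alpha> k - \<beta> k * harm k) / fact k * z ^ k) + ln z * (\<Sum>k. \<beta> k / fact k * z ^ k)"

abbreviation (input) shift :: "(nat \<Rightarrow> real) \<Rightarrow> nat \<Rightarrow> real" where
  "shift a \<equiv> \<lambda>k. a (Suc k)"

lemma harm_le_of_nat: "harm k \<le> real k"
proof (induction k)
  case (Suc k)
  have "inverse (real (Suc k)) \<le> 1" by (simp add: field_simps)
  then show ?case using Suc unfolding harm_Suc by simp
qed (simp add: harm_def)

text \<open>Since k + 1 \<le> 2^k, the exponential series at 2 |z| is a majorant.\<close>

lemma summable_linear_growth_div_fact:
  fixes c :: "nat \<Rightarrow> real"
  assumes "\<And>k. \<bar>c k\<bar> \<le> C * (real k + 1)"
  shows "summable (\<lambda>k. \<bar>c k / fact k * z ^ k\<bar>)"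
proof (rule summable_comparison_test)
  have "C \<ge> 0" using assms[of 0] by simp
  have "\<bar>c k / fact k * z ^ k\<bar> \<le> C * (inverse (fact k) * (2 * \<bar>z\<bar>) ^ k)" for k
  proof -
    have "real k + 1 \<le> 2 ^ k" by (induction k) auto
    then have "\<bar>c k\<bar> \<le> C * 2 ^ k"
      using assms[of k] mult_left_mono[of "real k + 1" "2 ^ k" C] \<open>C \<ge> 0\<close> by linarith
    then have "\<bar>c k\<bar> * (inverse (fact k) * \<bar>z\<bar> ^ k) \<le> C * 2 ^ k * (inverse (fact k) * \<bar>z\<bar> ^ k)"
      by (intro mult_right_mono) auto
    then show ?thesis
      by (simp add: abs_mult power_abs divide_inverse power_mult_distrib mult_ac)
  qed
  then show "\<exists>N. \<forall>k\<ge>N. norm \<bar>c k / fact k * z ^ k\<bar> \<le> C * (inverse (fact k) * (2 * \<bar>z\<bar>) ^ k)"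
    by auto
  show "summable (\<lambda>k. C * (inverse (fact k) * (2 * \<bar>z\<bar>) ^ k))"
    by (intro summable_mult summable_exp)
qed

lemma diffs_div_fact: "diffs (\<lambda>k. c k / fact k :: real) = (\<lambda>k. c (Suc k) / fact k)"
  by (simp add: diffs_def fun_eq_iff del: of_nat_Suc)

context
  fixes \<alpha> \<beta> :: "nat \<Rightarrow> real" and C :: real
  assumes bounded: "\<And>k. \<bar>\<alpha> k\<bar> \<le> C" "\<And>k. \<bar>\<beta> k\<bar> \<le> C"
begin

text \<open>Boundedness by \<open>C\<close> passes unchanged to shifted sequences, so every result
  of this context applies again to the derivatives. The harmonic correction spoils it only to linear
  growth.\<close>

lemma log_series_coeff_bounds:
  "\<bar>\<beta> k\<bar> \<le> C * (real k + 1)" "\<bar>\<alpha> k - \<beta> k * harm k\<bar> \<le> C * (real k + 1)"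
proof -
  have C: "C \<ge> 0" using bounded(1)[of 0] by linarith
  then have "0 \<le> C * real k" by simp
  then show "\<bar>\<beta> k\<bar> \<le> C * (real k + 1)"
    using bounded(2)[of k] unfolding distrib_left by linarith
  have "\<bar>\<beta> k * harm k\<bar> \<le> C * real k"
    unfolding abs_mult using harm_le_of_nat[of k] bounded(2)[of k] C
    by (intro mult_mono) (auto simp: harm_nonneg)
  then show "\<bar>\<alpha> k - \<beta> k * harm k\<bar> \<le> C * (real k + 1)"
    using bounded(1)[of k] by (simp add: distrib_left)
qed

lemma log_series_summable_abs:
  "summable (\<lambda>k. \<bar>(\<alpha> k - \<beta> k * harm k) / fact k * z ^ k\<bar>)" "summable (\<lambda>k. \<bar>\<beta> k / fact k * z ^ k\<bar>)"
  by (rule summable_linear_growth_div_fact[of _ C], rule log_series_coeff_bounds)+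

lemma log_series_summable:
  "summable (\<lambda>k. (\<alpha> k - \<beta> k * harm k) / fact k * z ^ k)" "summable (\<lambda>k. \<beta> k / fact k * z ^ k)"
  by (rule summable_rabs_cancel, rule log_series_summable_abs)+

text \<open>Beyond its head, the series multiplying \<open>ln z\<close> has a factor z, and z ln z
  tends to 0; \<open>r\<close> is that tail divided by z.\<close>

lemma log_series_tendsto:
  "((\<lambda>z. log_series \<alpha> \<beta> z - \<beta> 0 * ln z) \<longlongrightarrow> \<alpha> 0) (at_right 0)"
proof -
  define p q r where "p = (\<lambda>z::real. \<Sum>k. (\<alpha> k - \<beta> k * harm k) / fact k * z ^ k)"
    and "q = (\<lambda>z::real. \<Sum>k. \<beta> k / fact k * z ^ k)"
    and "r = (\<lambda>z::real. \<Sum>k. \<beta> (Suc k) / fact (Suc k) * z ^ k)"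
  have q0: "q z = \<beta> 0 + z * r z" for z
  proof -
    have "q z = (\<Sum>k. \<beta> (Suc k) / fact (Suc k) * z ^ Suc k) + \<beta> 0"
      unfolding q_def using suminf_split_head[OF log_series_summable(2)[of z]] by simp
    also have "(\<Sum>k. \<beta> (Suc k) / fact (Suc k) * z ^ Suc k) = z * r z"
    proof (cases "z = 0")
      case False
      have "summable (\<lambda>k. \<beta> (Suc k) / fact (Suc k) * z ^ Suc k)"
        using log_series_summable(2)[of z] by (subst summable_Suc_iff)
      then have "summable (\<lambda>k. inverse z * (\<beta> (Suc k) / fact (Suc k) * z ^ Suc k))"
        by (rule summable_mult)
      then have "summable (\<lambda>k. \<beta> (Suc k) / fact (Suc k) * z ^ k)"
        using False by (simp add: field_simps del: fact_Suc)
      from suminf_mult[OF this, of z] show ?thesis by (simp add: r_def mult_ac del: fact_Suc)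
    qed simp
    finally show ?thesis by simp
  qed
  have "isCont p 0" unfolding p_def
    by (rule isCont_powser_converges_everywhere) (rule log_series_summable)
  then have "(p \<longlongrightarrow> p 0) (at_right 0)"
    unfolding isCont_def by (rule filterlim_mono) (auto simp: at_le)
  moreover have "p 0 = \<alpha> 0" unfolding p_def powser_zero by (simp add: harm_def)
  \<comment> \<open>Continuity at 0 needs convergence at every point, 0 included, so division by z
    is no help here and the bound on \<open>\<beta>\<close> is used directly.\<close>
  moreover have "summable (\<lambda>k. \<beta> (Suc k) / fact (Suc k) * z ^ k)" for z :: real
  proof (rule summable_rabs_cancel, rule summable_comparison_test)
    show "\<exists>N. \<forall>k\<ge>N. norm \<bar>\<beta> (Suc k) / fact (Suc k) * z ^ k\<bar> \<le> C * (inverse (fact k) * \<bar>z\<bar> ^ k)"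
    proof (intro exI allI impI)
      fix k :: nat
      have "\<bar>\<beta> (Suc k)\<bar> / fact (Suc k) \<le> C / fact k"
        using bounded(2)[of "Suc k"] by (intro frac_le) (auto simp: fact_mono)
      then have "\<bar>\<beta> (Suc k)\<bar> / fact (Suc k) * \<bar>z\<bar> ^ k \<le> C / fact k * \<bar>z\<bar> ^ k"
        by (intro mult_right_mono) auto
      then show "norm \<bar>\<beta> (Suc k) / fact (Suc k) * z ^ k\<bar> \<le> C * (inverse (fact k) * \<bar>z\<bar> ^ k)"
        by (simp add: abs_mult power_abs divide_inverse mult_ac del: fact_Suc)
    qed
    show "summable (\<lambda>k. C * (inverse (fact k) * \<bar>z\<bar> ^ k))"
      by (intro summable_mult summable_exp)
  qed
  then have "isCont r 0" unfolding r_def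
    by (rule isCont_powser_converges_everywhere)
  then have "(r \<longlongrightarrow> r 0) (at_right 0)"
    unfolding isCont_def by (rule filterlim_mono) (auto simp: at_le)
  moreover have "((\<lambda>z::real. ln z * z) \<longlongrightarrow> 0) (at_right 0)" by real_asymp
  ultimately have "((\<lambda>z. p z + (ln z * z) * r z) \<longlongrightarrow> \<alpha> 0 + 0 * r 0) (at_right 0)"
    by (intro tendsto_intros) auto
  moreover have "log_series \<alpha> \<beta> z - \<beta> 0 * ln z = p z + (ln z * z) * r z" for z
  proof -
    have "log_series \<alpha> \<beta> z = p z + ln z * q z" by (simp only: log_series_def p_def q_def)
    then show ?thesis by (simp add: q0 algebra_simps)
  qed
  ultimately show ?thesis by simp
qed

lemma has_real_derivative_log_series:
  assumes "z > 0"
  shows "(log_series \<alpha> \<beta> has_real_derivative \<beta> 0 / z + log_series (shift \<alpha>) (shift \<beta>) z) (at z)"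
proof -
  \<comment> \<open>\<open>t\<close> stands for the tail of the logarithmic series divided by z; it
    enters with opposite signs from the two halves and cancels.\<close>
  have rearrange: "s - t + (c + t + d * l) = c + (s + l * d)" for s t c d l :: real
    by simp
  let ?p = "\<lambda>k. (\<alpha> k - \<beta> k * harm k) / fact k" and ?q = "\<lambda>k. \<beta> k / fact k"
  have p: "((\<lambda>z. \<Sum>k. ?p k * z ^ k) has_real_derivative (\<Sum>k. diffs ?p k * z ^ k)) (at z)"
    and q: "((\<lambda>z. \<Sum>k. ?q k * z ^ k) has_real_derivative (\<Sum>k. diffs ?q k * z ^ k)) (at z)"
    by (rule termdiffs_strong_converges_everywhere, rule log_series_summable)+
  have "(log_series \<alpha> \<beta> has_real_derivative
      (\<Sum>k. diffs ?p k * z ^ k) + ((\<Sum>k. ?q k * z ^ k) / z + (\<Sum>k. diffs ?q k * z ^ k) * ln z)) (at z)"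
    unfolding log_series_def [abs_def]
    by (rule derivative_eq_intros p q refl assms)+ (simp add: field_simps)
  also have "(\<Sum>k. ?q k * z ^ k) / z = \<beta> 0 / z + (\<Sum>k. ?q (Suc k) * z ^ k)"
  proof -
    have s: "summable (\<lambda>k. ?q (Suc k) * z ^ Suc k)"
      using log_series_summable(2)[of z] by (subst summable_Suc_iff)
    have "(\<Sum>k. ?q k * z ^ k) / z = ((\<Sum>k. ?q (Suc k) * z ^ Suc k) + \<beta> 0) / z"
      using suminf_split_head[OF log_series_summable(2)[of z]] by simp
    also have "\<dots> = \<beta> 0 / z + (\<Sum>k. ?q (Suc k) * z ^ Suc k / z)"
      using suminf_divide[OF s, of z] by (simp add: add_divide_distrib)
    finally show ?thesis using assms by simp
  qed
  also have "(\<Sum>k. diffs ?p k * z ^ k)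
      = (\<Sum>k. (\<alpha> (Suc k) - \<beta> (Suc k) * harm k) / fact k * z ^ k) - (\<Sum>k. ?q (Suc k) * z ^ k)"
  proof -
    have s1: "summable (\<lambda>k. diffs ?p k * z ^ k)"
      by (rule termdiff_converges_all) (rule log_series_summable)
    have s2: "summable (\<lambda>k. ?q (Suc k) * z ^ k)"
    proof -
      have "summable (\<lambda>k. ?q (Suc k) * z ^ Suc k)"
        using log_series_summable(2)[of z] by (subst summable_Suc_iff)
      from summable_divide[OF this, of z] show ?thesis using assms by simp
    qed
    \<comment> \<open>The product rule contributes exactly the 1 / (k + 1) by which
      \<open>harm (Suc k)\<close> exceeds \<open>harm k\<close>.\<close>
    have "diffs ?p k * z ^ k + ?q (Suc k) * z ^ k
        = (\<alpha> (Suc k) - \<beta> (Suc k) * harm k) / fact k * z ^ k" for k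
    proof -
      have "?q (Suc k) = \<beta> (Suc k) * inverse (real (Suc k)) / fact k"
        by (simp add: divide_inverse)
      then have "diffs ?p k + ?q (Suc k) = (\<alpha> (Suc k) - \<beta> (Suc k) * harm k) / fact k"
        unfolding diffs_div_fact harm_Suc
        by (simp add: algebra_simps diff_divide_distrib add_divide_distrib)
      then show ?thesis by (metis distrib_right)
    qed
    then show ?thesis using suminf_add[OF s1 s2] by simp
  qed
  also have "diffs ?q = (\<lambda>k. \<beta> (Suc k) / fact k)" by (rule diffs_div_fact)
  finally show ?thesis
    unfolding log_series_def [of "shift \<alpha>"] by (simp only: rearrange)
qed

end

text \<open>The hypotheses are the coefficient comparison at z^(k+1); the extra term in
  \<open>rec_\<alpha>\<close> is again the difference of consecutive harmonic numbers. The constant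
  \<open>\<alpha> 0\<close> has no partner in this comparison, which starts at the first
  power.\<close>

lemma log_series_ode:
  fixes \<alpha> \<beta> :: "nat \<Rightarrow> real"
  assumes bounded: "\<And>k. \<bar>\<alpha> k\<bar> \<le> C" "\<And>k. \<bar>\<beta> k\<bar> \<le> C"
    and "\<beta> 0 = 0"
    and rec_\<beta>: "\<And>k. real (Suc k) * \<beta> (k + 3) = - 2 * \<beta> (Suc k)"
    and rec_\<alpha>: "\<And>k. real (Suc k) * \<alpha> (k + 3) = - 2 * \<alpha> (Suc k) + 2 * \<beta> (Suc k) / real (Suc k)"
  shows "z * log_series (\<lambda>k. \<alpha> (k + 3)) (\<lambda>k. \<beta> (k + 3)) z = - 2 * (log_series \<alpha> \<beta> z - \<alpha> 0)"
proof -
  let ?p = "\<lambda>k. (\<alpha> k - \<beta> k * harm k) / fact k * z ^ k" and ?q = "\<lambda>k. \<beta> k / fact k * z ^ k"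
  let ?p3 = "\<lambda>k. (\<alpha> (k + 3) - \<beta> (k + 3) * harm k) / fact k * z ^ k"
  let ?q3 = "\<lambda>k. \<beta> (k + 3) / fact k * z ^ k"
  have s: "summable ?p" "summable ?q" by (rule log_series_summable[OF bounded])+
  have s3: "summable ?p3" "summable ?q3"
    by (rule log_series_summable[of "\<lambda>k. \<alpha> (k + 3)" C "\<lambda>k. \<beta> (k + 3)"]; rule bounded)+
  have q: "z * ?q3 k = - 2 * ?q (Suc k)" for k
  proof -
    have "z * ?q3 k = (real (Suc k) * \<beta> (k + 3)) / fact (Suc k) * z ^ Suc k"
      by (simp add: divide_simps del: of_nat_Suc)
    then show ?thesis unfolding rec_\<beta> by simp
  qed
  have p: "z * ?p3 k = - 2 * ?p (Suc k)" for k
  proof -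
    have "z * ?p3 k = (real (Suc k) * \<alpha> (k + 3) - real (Suc k) * \<beta> (k + 3) * harm k) / fact (Suc k) * z ^ Suc k"
      by (simp add: divide_simps del: of_nat_Suc) (simp add: algebra_simps)
    also have "real (Suc k) * \<alpha> (k + 3) - real (Suc k) * \<beta> (k + 3) * harm k
        = - 2 * (\<alpha> (Suc k) - \<beta> (Suc k) * harm (Suc k))"
      unfolding rec_\<alpha> rec_\<beta> harm_Suc by (simp add: algebra_simps divide_inverse del: of_nat_Suc)
    finally show ?thesis by (simp only: times_divide_eq_left times_divide_eq_right mult.assoc)
  qed
  have "z * (\<Sum>k. ?p3 k) = - 2 * (\<Sum>k. ?p (Suc k))"
    using suminf_mult[OF s3(1), of z] suminf_mult[OF summable_Suc_iff[THEN iffD2, OF s(1)], of "- 2"]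
    by (simp only: p)
  also have "(\<Sum>k. ?p (Suc k)) = (\<Sum>k. ?p k) - \<alpha> 0"
    using suminf_split_head[OF s(1)] \<open>\<beta> 0 = 0\<close> by simp
  finally have P: "z * (\<Sum>k. ?p3 k) = - 2 * ((\<Sum>k. ?p k) - \<alpha> 0)" .
  have "z * (\<Sum>k. ?q3 k) = - 2 * (\<Sum>k. ?q (Suc k))"
    using suminf_mult[OF s3(2), of z] suminf_mult[OF summable_Suc_iff[THEN iffD2, OF s(2)], of "- 2"]
    by (simp only: q)
  also have "(\<Sum>k. ?q (Suc k)) = (\<Sum>k. ?q k)"
    using suminf_split_head[OF s(2)] \<open>\<beta> 0 = 0\<close> by simp
  finally have Q: "z * (\<Sum>k. ?q3 k) = - 2 * (\<Sum>k. ?q k)" .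
  have "z * log_series (\<lambda>k. \<alpha> (k + 3)) (\<lambda>k. \<beta> (k + 3)) z = z * (\<Sum>k. ?p3 k) + ln z * (z * (\<Sum>k. ?q3 k))"
    unfolding log_series_def distrib_left by (simp only: mult.left_commute)
  also have "\<dots> = - 2 * (log_series \<alpha> \<beta> z - \<alpha> 0)"
    unfolding P Q log_series_def [of \<alpha>] right_diff_distrib distrib_left by (simp only: mult.left_commute)
  finally show ?thesis .
qed

subsection \<open>Uniqueness for the singular differential equation\<close>

lemma nonneg_of_deriv_nonneg:
  fixes h h' :: "real \<Rightarrow> real"
  assumes deriv: "\<And>t. 0 < t \<Longrightarrow> t \<le> X \<Longrightarrow> (h has_real_derivative h' t) (at t)"
    and nonneg: "\<And>t. 0 < t \<Longrightarrow> t \<le> X \<Longrightarrow> h' t \<ge> 0"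
    and lim: "(h \<longlongrightarrow> 0) (at_right 0)" and x: "0 < x" "x \<le> X"
  shows "h x \<ge> 0"
proof (rule tendsto_upperbound[OF lim])
  have "h s \<le> h x" if "0 < s" "s < x" for s
    using that x by (intro DERIV_nonneg_imp_nondecreasing[of s x h]) (auto intro!: exI deriv nonneg)
  then show "eventually (\<lambda>s. h s \<le> h x) (at_right 0)"
    using x by (auto simp: eventually_at_right_field)
qed auto

text \<open>Monotonicity of c t^(n+1) / (n+1) - f and of the same power plus f replaces integration
  of \<open>g\<close>, of which only a bound is used.\<close>

lemma abs_le_power_of_deriv:
  fixes f g :: "real \<Rightarrow> real"
  assumes f: "\<And>t. 0 < t \<Longrightarrow> (f has_real_derivative g t) (at t)"
    and lim: "(f \<longlongrightarrow> 0) (at_right 0)"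
    and g: "\<And>t. 0 < t \<Longrightarrow> t \<le> X \<Longrightarrow> \<bar>g t\<bar> \<le> c * t ^ n"
    and x: "0 < x" "x \<le> X"
  shows "\<bar>f x\<bar> \<le> c / real (Suc n) * x ^ Suc n"
proof -
  have P: "((\<lambda>t. c / real (Suc n) * t ^ Suc n) has_real_derivative c * t ^ n) (at t)" for t
    by (rule derivative_eq_intros refl)+ (simp del: of_nat_Suc)
  have lim': "((\<lambda>t. c / real (Suc n) * t ^ Suc n) \<longlongrightarrow> 0) (at_right 0)"
  proof -
    have "((\<lambda>t. c / real (Suc n) * t ^ Suc n) \<longlongrightarrow> c / real (Suc n) * 0 ^ Suc n) (at_right 0)"
      by (intro tendsto_intros)
    then show ?thesis by simp
  qed
  have "0 \<le> c / real (Suc n) * x ^ Suc n - f x"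
  proof (rule nonneg_of_deriv_nonneg[OF _ _ _ x])
    show "((\<lambda>t. c / real (Suc n) * t ^ Suc n - f t) has_real_derivative c * t ^ n - g t) (at t)"
      if "0 < t" for t using that by (intro DERIV_diff P f)
    show "c * t ^ n - g t \<ge> 0" if "0 < t" "t \<le> X" for t using g[OF that] by linarith
    show "((\<lambda>t. c / real (Suc n) * t ^ Suc n - f t) \<longlongrightarrow> 0) (at_right 0)"
      using tendsto_diff[OF lim' lim] by simp
  qed
  moreover have "0 \<le> c / real (Suc n) * x ^ Suc n + f x"
  proof (rule nonneg_of_deriv_nonneg[OF _ _ _ x])
    show "((\<lambda>t. c / real (Suc n) * t ^ Suc n + f t) has_real_derivative c * t ^ n + g t) (at t)"
      if "0 < t" for t using that by (intro DERIV_add P f)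
    show "c * t ^ n + g t \<ge> 0" if "0 < t" "t \<le> X" for t using g[OF that] by linarith
    show "((\<lambda>t. c / real (Suc n) * t ^ Suc n + f t) \<longlongrightarrow> 0) (at_right 0)"
      using tendsto_add[OF lim' lim] by simp
  qed
  ultimately show ?thesis by linarith
qed

lemma eq_0_of_deriv_eq_0:
  fixes f g :: "real \<Rightarrow> real"
  assumes "\<And>t. 0 < t \<Longrightarrow> (f has_real_derivative g t) (at t)"
    and "(f \<longlongrightarrow> 0) (at_right 0)" and "\<And>t. 0 < t \<Longrightarrow> t \<le> x \<Longrightarrow> g t = 0" and "0 < x"
  shows "f x = 0"
  using abs_le_power_of_deriv[of f g x 0 0 x] assms by simp

text \<open>Close to 0 the limit bounds the function, elsewhere compactness does. This starts the
  iteration below.\<close>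

lemma bounded_near_0:
  fixes f :: "real \<Rightarrow> real"
  assumes cont: "\<And>t. 0 < t \<Longrightarrow> isCont f t" and lim: "(f \<longlongrightarrow> 0) (at_right 0)"
  obtains B where "B \<ge> 0" "\<And>t. 0 < t \<Longrightarrow> t \<le> X \<Longrightarrow> \<bar>f t\<bar> \<le> B"
proof -
  have "eventually (\<lambda>t. \<bar>f t\<bar> < 1) (at_right 0)"
    using tendstoD[OF lim, of 1] by simp
  then obtain d where d: "d > 0" "\<And>t. 0 < t \<Longrightarrow> t < d \<Longrightarrow> \<bar>f t\<bar> < 1"
    by (auto simp: eventually_at_right_field)
  have "continuous_on {d..X} f"
    using d(1) cont by (intro continuous_at_imp_continuous_on) auto
  then have "bounded (f ` {d..X})"
    by (intro compact_imp_bounded compact_continuous_image) auto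
  then obtain B where "\<forall>y\<in>f ` {d..X}. norm y \<le> B"
    unfolding bounded_iff by blast
  then have B: "\<bar>f t\<bar> \<le> B" if "t \<in> {d..X}" for t using that by simp
  show ?thesis
  proof (rule that[of "max 1 B"])
    fix t :: real assume "0 < t" "t \<le> X"
    then show "\<bar>f t\<bar> \<le> max 1 B"
      using d(2)[of t] B[of t] by (cases "t < d") auto
  qed simp
qed

text \<open>The exponents at 0 are 0, 1 and 2, hence three vanishing limits. One round integrates
  twice, divides by t and integrates again, which gains t^2; the resulting bounds are terms of the
  series of B e^(2 t^2) and so tend to 0.\<close>

lemma singular_ode_unique:
  fixes D D' D'' :: "real \<Rightarrow> real"
  assumes d: "\<And>t. 0 < t \<Longrightarrow> (D has_real_derivative D' t) (at t)"
    and d1: "\<And>t. 0 < t \<Longrightarrow> (D' has_real_derivative D'' t) (at t)"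
    and d2: "\<And>t. 0 < t \<Longrightarrow> (D'' has_real_derivative - 2 * D t / t) (at t)"
    and lim: "(D \<longlongrightarrow> 0) (at_right 0)" "(D' \<longlongrightarrow> 0) (at_right 0)" "(D'' \<longlongrightarrow> 0) (at_right 0)"
    and X: "0 < X"
  shows "D X = 0"
proof -
  obtain B where B: "B \<ge> 0" "\<And>t. 0 < t \<Longrightarrow> t \<le> X \<Longrightarrow> \<bar>D'' t\<bar> \<le> B"
    by (rule bounded_near_0[of D'' X]) (use DERIV_isCont[OF d2] lim in auto)
  have bound: "0 < t \<Longrightarrow> t \<le> X \<Longrightarrow> \<bar>D'' t\<bar> \<le> B * 2 ^ m / fact m * t ^ (2 * m)" for m t
  proof (induction m arbitrary: t)
    case (Suc m)
    define c where "c = B * 2 ^ m / fact m"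
    have c: "c \<ge> 0" using B by (simp add: c_def)
    define c1 where "c1 = c / real (Suc (2 * m))"
    define c2 where "c2 = c1 / real (Suc (Suc (2 * m)))"
    define c3 where "c3 = 2 * c2 / real (Suc (Suc (2 * m)))"
    have 0: "\<bar>D'' t\<bar> \<le> c * t ^ (2 * m)" if "0 < t" "t \<le> X" for t
      unfolding c_def by (rule Suc.IH[OF that])
    have 1: "\<bar>D' t\<bar> \<le> c1 * t ^ Suc (2 * m)" if "0 < t" "t \<le> X" for t
      unfolding c1_def
      by (rule abs_le_power_of_deriv[OF d1 lim(2) 0 that])
    have 2: "\<bar>D t\<bar> \<le> c2 * t ^ Suc (Suc (2 * m))" if "0 < t" "t \<le> X" for t
      unfolding c2_def by (rule abs_le_power_of_deriv[OF d lim(1) 1 that])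
    have 3: "\<bar>- 2 * D t / t\<bar> \<le> 2 * c2 * t ^ Suc (2 * m)" if "0 < t" "t \<le> X" for t
      using 2[OF that] that by (simp add: abs_mult field_simps)
    have "\<bar>D'' t\<bar> \<le> c3 * t ^ Suc (Suc (2 * m))"
      unfolding c3_def by (rule abs_le_power_of_deriv[OF d2 lim(3) 3 Suc.prems])
    \<comment> \<open>The true gain is 2 / ((2 m + 1) (2 m + 2)^2); one factor of order m is enough
      to produce the factorial.\<close>
    also have "c3 \<le> c * 2 / real (Suc m)"
    proof -
      have "c1 \<le> c" "c1 \<ge> 0" using c by (simp_all add: c1_def divide_le_eq mult_le_cancel_left1)
      then have "c2 \<le> c" "c2 \<ge> 0" using c by (simp_all add: c2_def divide_le_eq) (simp add: distrib_left add_increasing2)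
      then show ?thesis unfolding c3_def by (intro frac_le) auto
    qed
    also have "c * 2 / real (Suc m) = B * 2 ^ Suc m / fact (Suc m)"
      by (simp add: c_def mult_ac)
    finally show ?case using Suc.prems by (simp add: mult_right_mono)
  qed (use B in simp)
  have "D'' t = 0" if t: "0 < t" "t \<le> X" for t
  proof -
    have "(\<lambda>m. inverse (fact m) * (2 * t\<^sup>2) ^ m) \<longlonglongrightarrow> 0"
      by (rule summable_LIMSEQ_zero[OF summable_exp])
    then have "(\<lambda>m. B * (inverse (fact m) * (2 * t\<^sup>2) ^ m)) \<longlonglongrightarrow> B * 0"
      by (rule tendsto_mult_left)
    moreover have "\<bar>D'' t\<bar> \<le> B * (inverse (fact m) * (2 * t\<^sup>2) ^ m)" for m
      using bound[OF t, of m] unfolding power_mult power_mult_distrib divide_inverse by (simp only: mult_ac)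
    ultimately have "\<bar>D'' t\<bar> \<le> B * 0"
      by (intro LIMSEQ_le_const) auto
    then show ?thesis by simp
  qed
  then have "D' t = 0" if "0 < t" "t \<le> X" for t
    using that by (intro eq_0_of_deriv_eq_0[OF d1 lim(2)]) auto
  then show ?thesis
    by (intro eq_0_of_deriv_eq_0[OF d lim(1)] X) auto
qed

subsection \<open>The coefficients of the expansion\<close>

text \<open>
  Up to the \<open>harm k\<close> correction, \<open>alpha \<nu> k\<close> is the coefficient of \<open>z ^ k / fact k\<close> in the formal expansion
  of \<open>exp (- z * y powr (- 1 / 2))\<close> under the integral, that is, \<open>(- 1) ^ k * Gamma (1 + \<nu> - k / 2)\<close>; at
  the poles of Gamma (even \<open>k > 2 * \<nu>\<close>) it is replaced by the contribution of a double pole, whose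
  logarithmic part is \<open>beta \<nu> k\<close>.
\<close>

definition alpha :: "nat \<Rightarrow> nat \<Rightarrow> real" where
  "alpha \<nu> k =
     (if odd k then - Gamma (1 + real \<nu> - real k / 2)
      else if k div 2 \<le> \<nu> then fact (\<nu> - k div 2)
      else let r = k div 2 - \<nu> - 1 in (- 1) ^ r * (harm r - 3 * euler_mascheroni) / fact r)"

definition beta :: "nat \<Rightarrow> nat \<Rightarrow> real" where
  "beta \<nu> k = (if odd k \<or> k div 2 \<le> \<nu> then 0 else - 2 * (- 1) ^ (k div 2 - \<nu> - 1) / fact (k div 2 - \<nu> - 1))"

text \<open>The shift by two indices is two differentiations, so this is F_(nu+1)'' = F_nu on the
  level of coefficients.\<close>

lemma alpha_Suc: "alpha (Suc \<nu>) (Suc (Suc k)) = alpha \<nu> k"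
  by (simp add: alpha_def add_divide_distrib add_diff_eq)

lemma beta_Suc: "beta (Suc \<nu>) (Suc (Suc k)) = beta \<nu> k"
  by (simp add: beta_def)

lemma alpha_odd: "alpha \<nu> (Suc (2 * j)) = - Gamma (1 / 2 + real \<nu> - real j)"
  by (simp add: alpha_def add_divide_distrib algebra_simps)

lemma half_nat_notin_nonpos_Ints: "1 / 2 + real m - real n \<notin> \<int>\<^sub>\<le>\<^sub>0"
proof
  assume "1 / 2 + real m - real n \<in> \<int>\<^sub>\<le>\<^sub>0"
  then have "1 / 2 + real m - real n \<in> \<int>" using nonpos_Ints_subset_Ints by blast
  then have "(1 / 2 + real m - real n) - real m + real n \<in> \<int>" by (intro Ints_add Ints_diff) auto
  then have "1 / 2 \<in> (\<int> :: real set)" by simp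
  then show False using fraction_not_in_Ints[of 2 "1::int", where 'a = real] by simp
qed

lemma Gamma_half_minus_Suc:
  "Gamma (1 / 2 + real m - real n) = (real m - real n - 1 / 2) * Gamma (1 / 2 + real m - real (Suc n))"
  using Gamma_plus1[OF half_nat_notin_nonpos_Ints[of m "Suc n"]] by (simp add: algebra_simps)

text \<open>Passing to \<open>Suc \<nu>\<close> adds only two new coefficients. For 0, the values
  |Gamma (1/2 - j)| decrease from j = 1 on, where the maximum 2 sqrt pi is attained, and factorials
  absorb the harmonic numbers.\<close>

lemma alpha_beta_bounded: "\<exists>C. \<forall>k. \<bar>alpha \<nu> k\<bar> \<le> C \<and> \<bar>beta \<nu> k\<bar> \<le> C"
proof (induction \<nu>)
  case 0
  have G: "\<bar>Gamma (1 / 2 - real j)\<bar> \<le> 2 * sqrt pi" for j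
  proof (induction j rule: less_induct)
    case (less j)
    show ?case
    proof (cases j)
      case 0
      then show ?thesis by (simp add: Gamma_one_half_real)
    next
      case (Suc i)
      have eq: "\<bar>Gamma (1 / 2 - real i)\<bar> = (real i + 1 / 2) * \<bar>Gamma (1 / 2 - real j)\<bar>"
      proof -
        have "Gamma (1 / 2 - real i) = - ((real i + 1 / 2) * Gamma (1 / 2 - real j))"
          unfolding Suc using Gamma_half_minus_Suc[of 0 i] by (simp add: algebra_simps)
        then show ?thesis by (simp add: abs_mult)
      qed
      show ?thesis
      proof (cases i)
        case 0
        then show ?thesis using eq by (simp add: Gamma_one_half_real)
      next
        case (Suc h)
        then have "1 * \<bar>Gamma (1 / 2 - real j)\<bar> \<le> (real i + 1 / 2) * \<bar>Gamma (1 / 2 - real j)\<bar>"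
          by (intro mult_right_mono) auto
        then show ?thesis using eq less.IH[of i] \<open>j = Suc i\<close> by simp
      qed
    qed
  qed
  have E: "\<bar>(- 1) ^ r * (harm r - 3 * euler_mascheroni) / fact r :: real\<bar> \<le> 4" for r
  proof -
    have "real r \<le> real (fact r)" unfolding of_nat_le_iff by (rule fact_ge_self)
    then have "real r \<le> fact r" unfolding of_nat_fact .
    moreover have "(1 :: real) \<le> fact r" by (rule fact_ge_1)
    moreover have "harm r \<le> real r" "(0 :: real) \<le> harm r" by (rule harm_le_of_nat harm_nonneg)+
    moreover have "(0 :: real) < euler_mascheroni" "(euler_mascheroni :: real) < 13 / 22"
      by (rule euler_mascheroni_pos euler_mascheroni_less_13_over_22)+
    ultimately have "\<bar>harm r - 3 * euler_mascheroni :: real\<bar> \<le> 4 * fact r" by linarith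
    then show ?thesis by (simp add: abs_mult divide_le_eq)
  qed
  show ?case
  proof (intro exI[of _ "4 + 2 * sqrt pi"] allI conjI)
    fix k
    show "\<bar>alpha 0 k\<bar> \<le> 4 + 2 * sqrt pi"
    proof (cases "odd k")
      case True
      then obtain j where "k = Suc (2 * j)" by (auto elim: oddE)
      then show ?thesis using G[of j] by (simp add: alpha_odd)
    next
      case False
      have "0 \<le> sqrt pi" by simp
      then show ?thesis
        using False E[of "k div 2 - 1"] by (simp add: alpha_def Let_def del: real_sqrt_ge_0_iff)
    qed
    have "2 / fact r \<le> 4 + 2 * sqrt pi" for r
    proof -
      have "2 / fact r \<le> (2 :: real)"
        using fact_ge_1[of r, where 'a = real] by (simp add: divide_le_eq)
      moreover have "0 \<le> sqrt pi" by simp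
      ultimately show ?thesis by linarith
    qed
    then show "\<bar>beta 0 k\<bar> \<le> 4 + 2 * sqrt pi"
      by (simp add: beta_def abs_mult)
  qed
next
  case (Suc \<nu>)
  then obtain C where C: "\<And>k. \<bar>alpha \<nu> k\<bar> \<le> C" "\<And>k. \<bar>beta \<nu> k\<bar> \<le> C" by blast
  define B where "B = C + \<bar>alpha (Suc \<nu>) 0\<bar> + \<bar>alpha (Suc \<nu>) 1\<bar> + \<bar>beta (Suc \<nu>) 0\<bar> + \<bar>beta (Suc \<nu>) 1\<bar>"
  have "C \<ge> 0" using C(1)[of 0] by linarith
  have "\<bar>alpha (Suc \<nu>) k\<bar> \<le> B \<and> \<bar>beta (Suc \<nu>) k\<bar> \<le> B" for k
  proof (cases "k < 2")
    case True
    then have "k = 0 \<or> k = 1" by linarith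
    then show ?thesis using \<open>C \<ge> 0\<close> by (auto simp: B_def)
  next
    case False
    then obtain i where i: "k = Suc (Suc i)" by (metis add_2_eq_Suc le_Suc_ex not_less)
    have "C \<le> B" by (simp add: B_def)
    then show ?thesis using C[of i] by (simp add: i alpha_Suc beta_Suc)
  qed
  then show ?case by blast
qed

section \<open>Identity of the integral and the logarithmic series\<close>

definition I1_series :: "nat \<Rightarrow> real \<Rightarrow> real" where
  "I1_series \<nu> = log_series (alpha \<nu>) (beta \<nu>)"

lemma beta_eq_0: "beta \<nu> 0 = 0" "beta \<nu> 1 = 0"
  by (simp_all add: beta_def)

lemma I1_series_deriv:
  assumes "z > 0"
  shows "(I1_series \<nu> has_real_derivative log_series (shift (alpha \<nu>)) (shift (beta \<nu>)) z) (at z)"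
    and "(log_series (shift (alpha \<nu>)) (shift (beta \<nu>)) has_real_derivative
      log_series (shift (shift (alpha \<nu>))) (shift (shift (beta \<nu>))) z) (at z)"
    and "(log_series (shift (shift (alpha \<nu>))) (shift (shift (beta \<nu>))) has_real_derivative
      beta \<nu> 2 / z + log_series (\<lambda>k. alpha \<nu> (k + 3)) (\<lambda>k. beta \<nu> (k + 3)) z) (at z)"
proof -
  obtain C where C: "\<And>k. \<bar>alpha \<nu> k\<bar> \<le> C" "\<And>k. \<bar>beta \<nu> k\<bar> \<le> C"
    using alpha_beta_bounded by blast
  show "(I1_series \<nu> has_real_derivative log_series (shift (alpha \<nu>)) (shift (beta \<nu>)) z) (at z)"
    using has_real_derivative_log_series[of "alpha \<nu>" C "beta \<nu>", OF C assms] by (simp add: I1_series_def beta_eq_0)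
  show "(log_series (shift (alpha \<nu>)) (shift (beta \<nu>)) has_real_derivative
      log_series (shift (shift (alpha \<nu>))) (shift (shift (beta \<nu>))) z) (at z)"
    using has_real_derivative_log_series[of "shift (alpha \<nu>)" C "shift (beta \<nu>)" z, OF C assms] beta_eq_0
    by simp
  have "Suc (Suc (Suc k)) = k + 3" for k by simp
  then show "(log_series (shift (shift (alpha \<nu>))) (shift (shift (beta \<nu>))) has_real_derivative
      beta \<nu> 2 / z + log_series (\<lambda>k. alpha \<nu> (k + 3)) (\<lambda>k. beta \<nu> (k + 3)) z) (at z)"
    using has_real_derivative_log_series[of "shift (shift (alpha \<nu>))" C "shift (shift (beta \<nu>))" z, OF C assms]
    by (simp only: numeral_2_eq_2)
qed

lemma I1_series_lim:
  shows "(I1_series \<nu> \<longlongrightarrow> fact \<nu>) (at_right 0)"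
    and "(log_series (shift (alpha \<nu>)) (shift (beta \<nu>)) \<longlongrightarrow> - Gamma (1 / 2 + real \<nu>)) (at_right 0)"
    and "((\<lambda>z. log_series (shift (shift (alpha \<nu>))) (shift (shift (beta \<nu>))) z - beta \<nu> 2 * ln z)
      \<longlongrightarrow> alpha \<nu> 2) (at_right 0)"
proof -
  obtain C where C: "\<And>k. \<bar>alpha \<nu> k\<bar> \<le> C" "\<And>k. \<bar>beta \<nu> k\<bar> \<le> C"
    using alpha_beta_bounded by blast
  show "(I1_series \<nu> \<longlongrightarrow> fact \<nu>) (at_right 0)"
    using log_series_tendsto[of "alpha \<nu>" C "beta \<nu>", OF C] by (simp add: I1_series_def beta_eq_0 alpha_def)
  show "(log_series (shift (alpha \<nu>)) (shift (beta \<nu>)) \<longlongrightarrow> - Gamma (1 / 2 + real \<nu>)) (at_right 0)"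
    using log_series_tendsto[of "shift (alpha \<nu>)" C "shift (beta \<nu>)", OF C] alpha_odd[of \<nu> 0] beta_eq_0
    by simp
  show "((\<lambda>z. log_series (shift (shift (alpha \<nu>))) (shift (shift (beta \<nu>))) z - beta \<nu> 2 * ln z)
      \<longlongrightarrow> alpha \<nu> 2) (at_right 0)"
    using log_series_tendsto[of "shift (shift (alpha \<nu>))" C "shift (shift (beta \<nu>))", OF C]
    by (simp only: numeral_2_eq_2)
qed

lemma beta_0_rec: "real (Suc k) * beta 0 (k + 3) = - 2 * beta 0 (Suc k)"
proof (cases "odd k")
  case True
  then obtain i where k: "k = Suc (2 * i)" by (auto elim: oddE)
  have "k + 3 = 2 * (i + 2)" "Suc k = 2 * (i + 1)" by (simp_all add: k)
  then have eq: "beta 0 (k + 3) = - 2 * (- 1) ^ Suc i / fact (Suc i)" "beta 0 (Suc k) = - 2 * (- 1) ^ i / fact i"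
    "real (Suc k) = 2 * real (Suc i)"
    by (simp_all only: beta_def) simp_all
  show ?thesis unfolding eq by (simp add: divide_simps del: of_nat_Suc)
next
  case False
  then show ?thesis by (simp add: beta_def)
qed

text \<open>For odd k the increment 1 / (i + 1) of the harmonic number is exactly the
  \<open>beta\<close> term; for even k this is the functional equation of Gamma. The recurrence
  would accept any constant in place of -3 gamma, which is fixed only by the limit of the second
  derivative.\<close>

lemma alpha_0_rec:
  "real (Suc k) * alpha 0 (k + 3) = - 2 * alpha 0 (Suc k) + 2 * beta 0 (Suc k) / real (Suc k)"
proof (cases "odd k")
  case True
  then obtain i where k: "k = Suc (2 * i)" by (auto elim: oddE)
  let ?h = "harm i - 3 * euler_mascheroni :: real"
  have k': "k + 3 = 2 * (i + 2)" "Suc k = 2 * (i + 1)" by (simp_all add: k)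
  have a3: "alpha 0 (k + 3) = (- 1) ^ Suc i * (?h + 1 / real (Suc i)) / fact (Suc i)"
    unfolding k' alpha_def by (simp add: Let_def harm_Suc inverse_eq_divide del: of_nat_Suc fact_Suc)
  have a1: "alpha 0 (Suc k) = (- 1) ^ i * ?h / fact i" and b1: "beta 0 (Suc k) = - 2 * (- 1) ^ i / fact i"
    unfolding k' alpha_def beta_def by (simp_all add: Let_def)
  have r: "real (Suc k) = 2 * real (Suc i)" by (simp add: k)
  show ?thesis
    unfolding a3 a1 b1 r by (simp add: divide_simps del: of_nat_Suc) (simp add: algebra_simps)
next
  case False
  then obtain j where k: "k = 2 * j" by (auto elim: evenE)
  have "alpha 0 (k + 3) = - Gamma (1 / 2 - real (Suc j))"
    using alpha_odd[of 0 "Suc j"] by (simp add: k eval_nat_numeral)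
  moreover have "alpha 0 (Suc k) = - Gamma (1 / 2 - real j)"
    using alpha_odd[of 0 j] by (simp add: k)
  moreover have "beta 0 (Suc k) = 0" using False by (simp add: beta_def)
  ultimately show ?thesis
    using Gamma_half_minus_Suc[of 0 j] by (simp add: k algebra_simps)
qed

lemma I1_eq_series_0:
  assumes "z > 0"
  shows "I1 z 0 = I1_series 0 z"
proof -
  let ?L1 = "log_series (shift (alpha 0)) (shift (beta 0))"
  let ?L2 = "log_series (shift (shift (alpha 0))) (shift (shift (beta 0)))"
  let ?L3 = "log_series (\<lambda>k. alpha 0 (k + 3)) (\<lambda>k. beta 0 (k + 3))"
  have coeffs: "beta 0 2 = -2" "alpha 0 2 = - 3 * euler_mascheroni" "alpha 0 0 = 1"
    by (simp_all add: alpha_def beta_def harm_def)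
  have "I1 z 0 - I1_series 0 z = 0"
  proof (rule singular_ode_unique[where D = "\<lambda>z. I1 z 0 - I1_series 0 z" and X = z
      and D' = "\<lambda>z. - I1 z (- 1 / 2) - ?L1 z" and D'' = "\<lambda>z. I1 z (- 1) - ?L2 z"])
    fix t :: real assume t: "t > 0"
    show "((\<lambda>z. I1 z 0 - I1_series 0 z) has_real_derivative - I1 t (- 1 / 2) - ?L1 t) (at t)"
      using DERIV_diff[OF has_real_derivative_I1[OF t, of 0] I1_series_deriv(1)[OF t, of 0]] by simp
    show "((\<lambda>z. - I1 z (- 1 / 2) - ?L1 z) has_real_derivative I1 t (- 1) - ?L2 t) (at t)"
      using DERIV_diff[OF DERIV_minus[OF has_real_derivative_I1[OF t, of "- 1 / 2"]] I1_series_deriv(2)[OF t, of 0]]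
      by simp
    have "t * ?L3 t = - 2 * (I1_series 0 t - alpha 0 0)"
    proof -
      obtain C where C: "\<And>k. \<bar>alpha 0 k\<bar> \<le> C" "\<And>k. \<bar>beta 0 k\<bar> \<le> C"
        using alpha_beta_bounded by blast
      show ?thesis
        unfolding I1_series_def by (rule log_series_ode[of "alpha 0" C "beta 0", OF C beta_eq_0(1) beta_0_rec alpha_0_rec])
    qed
    \<comment> \<open>The singular term \<open>beta 0 2 / t\<close>, equal to -2 / t, makes up for
      the constant \<open>alpha 0 0 = 1\<close> missing from the series equation.\<close>
    then have "- I1 t (- 1 - 1 / 2) - (beta 0 2 / t + ?L3 t) = - 2 * (I1 t 0 - I1_series 0 t) / t"
      using I1_0_eq[OF t] t by (simp add: coeffs field_simps)
    then show "((\<lambda>z. I1 z (- 1) - ?L2 z) has_real_derivative - 2 * (I1 t 0 - I1_series 0 t) / t) (at t)"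
      using DERIV_diff[OF has_real_derivative_I1[OF t, of "- 1"] I1_series_deriv(3)[OF t, of 0]] by simp
  next
    show "((\<lambda>z. I1 z 0 - I1_series 0 z) \<longlongrightarrow> 0) (at_right 0)"
      using tendsto_diff[OF tendsto_I1_at_right_0[of 0] I1_series_lim(1)[of 0]] by simp
    show "((\<lambda>z. - I1 z (- 1 / 2) - ?L1 z) \<longlongrightarrow> 0) (at_right 0)"
      using tendsto_diff[OF tendsto_minus[OF tendsto_I1_at_right_0[of "- 1 / 2"]] I1_series_lim(2)[of 0]] by simp
    show "((\<lambda>z. I1 z (- 1) - ?L2 z) \<longlongrightarrow> 0) (at_right 0)"
      using tendsto_diff[OF tendsto_I1_minus_1 I1_series_lim(3)[of 0]] by (simp add: coeffs)
  qed (rule assms)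
  then show ?thesis by simp
qed

lemma I1_eq_series:
  assumes "z > 0"
  shows "I1 z (real \<nu>) = I1_series \<nu> z"
  using assms
proof (induction \<nu> arbitrary: z)
  case 0
  then show ?case using I1_eq_series_0 by simp
next
  case (Suc \<nu>)
  let ?L1 = "log_series (shift (alpha (Suc \<nu>))) (shift (beta (Suc \<nu>)))"
  define D where "D = (\<lambda>z. I1 z (real (Suc \<nu>)) - I1_series (Suc \<nu>) z)"
  define D1 where "D1 = (\<lambda>z. - I1 z (real \<nu> + 1 / 2) - ?L1 z)"
  have d: "(D has_real_derivative D1 t) (at t)" if t: "t > 0" for t
    using DERIV_diff[OF has_real_derivative_I1[OF t, of "real (Suc \<nu>)"] I1_series_deriv(1)[OF t, of "Suc \<nu>"]]
    by (simp add: D_def D1_def add_diff_eq algebra_simps)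
  have d1: "(D1 has_real_derivative I1 t (real \<nu>) - I1_series \<nu> t) (at t)" if t: "t > 0" for t
    using DERIV_diff[OF DERIV_minus[OF has_real_derivative_I1[OF t, of "real \<nu> + 1 / 2"]]
        I1_series_deriv(2)[OF t, of "Suc \<nu>"]]
    by (simp add: D1_def alpha_Suc beta_Suc I1_series_def)
  have lim: "(D \<longlongrightarrow> 0) (at_right 0)"
  proof -
    have "Gamma (real (Suc \<nu>) + 1) = fact (Suc \<nu>)"
      using Gamma_fact[of "Suc \<nu>", where 'a = real] by (simp add: add.commute)
    then show ?thesis
      using tendsto_diff[OF tendsto_I1_at_right_0[of "real (Suc \<nu>)"] I1_series_lim(1)[of "Suc \<nu>"]]
      by (simp add: D_def del: fact_Suc of_nat_Suc)
  qed
  have lim1: "(D1 \<longlongrightarrow> 0) (at_right 0)"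
  proof -
    have eq: "real \<nu> + 1 / 2 + 1 = 1 / 2 + real (Suc \<nu>)" by simp
    have "(D1 \<longlongrightarrow> - Gamma (real \<nu> + 1 / 2 + 1) - - Gamma (1 / 2 + real (Suc \<nu>))) (at_right 0)"
      unfolding D1_def by (intro tendsto_diff tendsto_minus tendsto_I1_at_right_0 I1_series_lim) simp
    then show ?thesis unfolding eq by simp
  qed
  have "D1 t = 0" if "t > 0" for t
    by (rule eq_0_of_deriv_eq_0[OF d1 lim1]) (use Suc.IH that in auto)
  then have "D z = 0"
    by (intro eq_0_of_deriv_eq_0[OF d lim]) (use Suc.prems in auto)
  then show ?case by (simp add: D_def)
qed

section \<open>Coefficients in terms of Pochhammer symbols and harmonic numbers\<close>

lemma pochhammer_minus_mult_fact:
  "j \<le> n \<Longrightarrow> pochhammer (- real n) j * fact (n - j) = (- 1) ^ j * fact n"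
proof (induction j)
  case (Suc j)
  have "n - j = Suc (n - Suc j)" using Suc.prems by simp
  then have eq: "(fact (n - j) :: real) = (real n - real j) * fact (n - Suc j)"
    using Suc.prems by (simp add: of_nat_diff)
  have "pochhammer (- real n) (Suc j) * fact (n - Suc j) = - (pochhammer (- real n) j * fact (n - j))"
    unfolding pochhammer_Suc eq by (simp add: algebra_simps)
  then show ?case using Suc by simp
qed simp

text \<open>The functional equation applied r times; it turns the Gamma values at odd indices into
  the hypergeometric parameter 1/2 - n.\<close>

lemma Gamma_half_pochhammer:
  "pochhammer (1 / 2 - real n) r * Gamma (1 / 2 + real n - real r) = (- 1) ^ r * Gamma (1 / 2 + real n)"
proof (induction r)
  case (Suc r)
  have "pochhammer (1 / 2 - real n) (Suc r) * Gamma (1 / 2 + real n - real (Suc r))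
      = - (pochhammer (1 / 2 - real n) r * ((real n - real r - 1 / 2) * Gamma (1 / 2 + real n - real (Suc r))))"
    by (simp add: pochhammer_Suc algebra_simps)
  also have "\<dots> = - (pochhammer (1 / 2 - real n) r * Gamma (1 / 2 + real n - real r))"
    by (subst Gamma_half_minus_Suc[of n r]) (rule refl)
  finally show ?case using Suc by simp
qed simp

lemma fact_Suc_double: "(fact (Suc (2 * n)) :: real) = 4 ^ n * pochhammer (3 / 2) n * fact n"
proof (induction n)
  case (Suc n)
  have "(fact (Suc (2 * Suc n)) :: real) = (2 * real n + 3) * (2 * real n + 2) * fact (Suc (2 * n))"
    by (simp add: algebra_simps)
  also have "\<dots> = 4 ^ Suc n * pochhammer (3 / 2) (Suc n) * fact (Suc n)"
    unfolding Suc by (simp add: pochhammer_Suc algebra_simps)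
  finally show ?case .
qed simp

text \<open>Even and odd denominators are separated; the odd ones, halved, form the half-integer
  bracket of \<open>A_coeff\<close>.\<close>

lemma harm_double: "2 * harm (2 * n) = harm n + (\<Sum>k<n. 1 / (1 / 2 + real k))"
proof (induction n)
  case (Suc n)
  have "2 * harm (2 * Suc n) = 2 * harm (2 * n) + 2 * inverse (2 * real n + 1) + 2 * inverse (2 * real n + 2)"
    by (simp add: harm_Suc algebra_simps)
  also have "2 * inverse (2 * real n + 2) = inverse (real (Suc n))" by (simp add: field_simps)
  also have "2 * inverse (2 * real n + 1) = 1 / (1 / 2 + real n)" by (simp add: field_simps)
  finally show ?case using Suc by (simp add: harm_Suc del: of_nat_Suc)
qed (simp add: harm_def)

text \<open>The last two brackets of \<open>A_coeff\<close> merge into one harmonic number of even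
  index, and its -2 ln 2 cancels the 4 in \<open>z\<^sup>2 / 4\<close>.\<close>

lemma ln_plus_A_coeff:
  assumes "z > 0"
  shows "- ln (z\<^sup>2 / 4) + A_coeff \<nu> r
    = harm r - 3 * euler_mascheroni + 2 * harm (2 * (r + \<nu> + 1)) - 2 * ln z"
proof -
  have "ln (4 :: real) = 2 * ln 2" using ln_realpow[of 2 2] by simp
  then have "ln (z\<^sup>2 / 4) = 2 * ln z - 2 * ln 2"
    using assms by (simp add: ln_div ln_realpow)
  moreover have "{0..\<nu> + r} = {..<r + \<nu> + 1}" by auto
  ultimately show ?thesis
    unfolding A_coeff_def harm_double by simp
qed

text \<open>Multiplying by \<open>pochhammer (1 / 2) (\<nu> + 1)\<close> reduces the Gamma value to
  sqrt pi and completes the Pochhammer symbol in the denominator, which with the factorial gives (2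
  j)! / 4^j.\<close>

lemma B_coeff_eq:
  "B_coeff \<nu> r = sqrt pi * 4 ^ (r + \<nu> + 1) * (- 1) ^ r / (fact r * fact (2 * (r + \<nu> + 1)))"
proof -
  define j where "j = r + \<nu> + 1"
  have G: "pochhammer (1 / 2) (\<nu> + 1) * Gamma (- 1 / 2 - real \<nu>) = (- 1) ^ (\<nu> + 1) * sqrt pi"
  proof -
    have eq: "1 / 2 + real 0 - real (\<nu> + 1) = - 1 / 2 - real \<nu>" by simp
    show ?thesis
      using Gamma_half_pochhammer[of 0 "\<nu> + 1"] unfolding eq by (simp add: Gamma_one_half_real)
  qed
  have P: "pochhammer (1 / 2) j = pochhammer (1 / 2) (\<nu> + 1) * pochhammer (3 / 2 + real \<nu>) r"
    using pochhammer_product'[of "1 / 2 :: real" "\<nu> + 1" r] by (simp add: j_def add_ac)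
  have pos: "pochhammer (1 / 2 :: real) (\<nu> + 1) > 0" "pochhammer (3 / 2 + real \<nu>) r > 0"
    by (intro pochhammer_pos; simp)+
  have "B_coeff \<nu> r = (- 1) ^ (1 + \<nu> + r) * (pochhammer (1 / 2) (\<nu> + 1) * Gamma (- 1 / 2 - real \<nu>))
      / (fact r * (pochhammer (1 / 2) j * fact j))"
    unfolding B_coeff_def P j_def [symmetric] using pos by (simp add: divide_simps)
  also have "(- 1) ^ (1 + \<nu> + r) * (pochhammer (1 / 2) (\<nu> + 1) * Gamma (- 1 / 2 - real \<nu>)) = (- 1) ^ r * sqrt pi"
    unfolding G by (simp add: power_add)
  also have "pochhammer (1 / 2 :: real) j * fact j = fact (2 * j) / 4 ^ j"
    unfolding fact_double by (simp add: power_mult)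
  finally show ?thesis by (simp add: j_def)
qed

lemma suminf_even_odd:
  fixes f :: "nat \<Rightarrow> real"
  assumes "summable (\<lambda>n. f (2 * n))" "summable (\<lambda>n. f (Suc (2 * n)))"
  shows "(\<Sum>n. f n) = (\<Sum>n. f (2 * n)) + (\<Sum>n. f (Suc (2 * n)))"
proof -
  have "(\<lambda>n. if even n then f (2 * (n div 2)) else f (Suc (2 * ((n - 1) div 2))))
      sums ((\<Sum>n. f (Suc (2 * n))) + (\<Sum>n. f (2 * n)))"
    by (intro sums_if summable_sums assms)
  moreover have "(if even n then f (2 * (n div 2)) else f (Suc (2 * ((n - 1) div 2)))) = f n" for n
    by (auto elim!: oddE)
  ultimately show ?thesis by (simp add: sums_iff)
qed

theorem theorem5p1:
  fixes \<nu> :: nat and z :: real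
  assumes "z > 0"
  shows "I1_converges z (real \<nu>)
    \<and> summable (hyp0F2_term (3 / 2) (1 / 2 - real \<nu>) (- (z\<^sup>2 / 4)))
    \<and> summable (\<lambda>r. (z\<^sup>2 / 4) ^ r * (- ln (z\<^sup>2 / 4) + A_coeff \<nu> r) * B_coeff \<nu> r)
    \<and> I1 z (real \<nu>) =
        Gamma (1 + real \<nu>)
          * (\<Sum>r=0..\<nu>. 1 / (pochhammer (1 / 2) r * pochhammer (- real \<nu>) r * fact r)
                       * (- (z\<^sup>2 / 4)) ^ r)
        - 2 * Gamma (1 / 2 + real \<nu>) * (z\<^sup>2 / 4) powr (1 / 2)
          * hyp0F2 (3 / 2) (1 / 2 - real \<nu>) (- (z\<^sup>2 / 4))
        + pi powr (- 1 / 2) * (z\<^sup>2 / 4) ^ (1 + \<nu>)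
          * (\<Sum>r. (z\<^sup>2 / 4) ^ r * (- ln (z\<^sup>2 / 4) + A_coeff \<nu> r) * B_coeff \<nu> r)"
proof -
  define x where "x = z\<^sup>2 / 4"
  define hyp where "hyp = hyp0F2_term (3 / 2) (1 / 2 - real \<nu>) (- x)"
  define ser where "ser = (\<lambda>r. x ^ r * (- ln x + A_coeff \<nu> r) * B_coeff \<nu> r)"
  define p where "p = (\<lambda>k. (alpha \<nu> k - beta \<nu> k * harm k) / fact k * z ^ k)"
  define q where "q = (\<lambda>k. beta \<nu> k / fact k * z ^ k)"
  define t where "t = (\<lambda>k. p k + ln z * q k)"
  have x: "x > 0" "4 * x = z\<^sup>2" using assms by (simp_all add: x_def)
  have z_even: "z ^ (2 * j) = 4 ^ j * x ^ j" for j
    by (simp only: power_mult x(2) [symmetric] power_mult_distrib)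
  have x_powr: "x powr (1 / 2) = z / 2"
    using assms by (simp add: x_def powr_half_sqrt real_sqrt_divide)
  have Gamma_nz: "Gamma (1 / 2 + real \<nu>) \<noteq> 0"
    using Gamma_real_pos[of "1 / 2 + real \<nu>"] by linarith
  obtain C where C: "\<And>k. \<bar>alpha \<nu> k\<bar> \<le> C" "\<And>k. \<bar>beta \<nu> k\<bar> \<le> C"
    using alpha_beta_bounded by blast
  have pq: "summable p" "summable q" unfolding p_def q_def by (rule log_series_summable[of "alpha \<nu>" C "beta \<nu>", OF C])+
  \<comment> \<open>Absolute convergence is what allows subseries to be extracted.\<close>
  have abs_t: "summable (\<lambda>k. \<bar>t k\<bar>)"
  proof (rule summable_comparison_test)
    show "summable (\<lambda>k. \<bar>p k\<bar> + \<bar>ln z\<bar> * \<bar>q k\<bar>)"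
      unfolding p_def q_def by (intro summable_add summable_mult log_series_summable_abs[of "alpha \<nu>" C "beta \<nu>", OF C])
    have "norm \<bar>t k\<bar> \<le> \<bar>p k\<bar> + \<bar>ln z\<bar> * \<bar>q k\<bar>" for k
      using abs_triangle_ineq[of "p k" "ln z * q k"] by (simp add: t_def abs_mult)
    then show "\<exists>N. \<forall>k\<ge>N. norm \<bar>t k\<bar> \<le> \<bar>p k\<bar> + \<bar>ln z\<bar> * \<bar>q k\<bar>" by blast
  qed
  have sub: "summable (\<lambda>n. t (g n))" if "inj g" for g
    by (rule summable_rabs_cancel) (use summable_reindex[OF abs_t that] in \<open>simp add: o_def\<close>)
  have sum_t: "I1 z (real \<nu>) = (\<Sum>k. t k)"
    unfolding I1_eq_series[OF assms] I1_series_def log_series_def t_def p_def [symmetric] q_def [symmetric]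
    using suminf_add[OF pq(1) summable_mult[OF pq(2), of "ln z"]] suminf_mult[OF pq(2), of "ln z"] by simp
  \<comment> \<open>The three pieces of the expansion are the even indices up to
    \<open>2 * \<nu>\<close>, the odd indices, and the even indices from
    \<open>2 * \<nu> + 2\<close> on.\<close>
  have t_small: "t (2 * j) = Gamma (1 + real \<nu>) *
      (1 / (pochhammer (1 / 2) j * pochhammer (- real \<nu>) j * fact j) * (- x) ^ j)" if "j \<le> \<nu>" for j
  proof -
    \<comment> \<open>Division by 0 yields 0, so the denominators of the finite sum must be seen not
      to vanish.\<close>
    have "pochhammer (- real \<nu>) j * fact (\<nu> - j) \<noteq> 0"
      unfolding pochhammer_minus_mult_fact[OF that] by simp
    then have nz: "pochhammer (- real \<nu>) j \<noteq> 0" by auto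
    have "t (2 * j) = fact (\<nu> - j) / fact (2 * j) * z ^ (2 * j)"
      using that by (simp add: t_def p_def q_def alpha_def beta_def)
    also have "fact (\<nu> - j) = (- 1) ^ j * fact \<nu> / pochhammer (- real \<nu>) j"
      using pochhammer_minus_mult_fact[OF that] nz by (simp add: field_simps)
    also have "fact (2 * j) = 4 ^ j * pochhammer (1 / 2 :: real) j * fact j"
      unfolding fact_double by (simp add: power_mult)
    finally show ?thesis
      unfolding z_even using Gamma_fact[of \<nu>, where 'a = real]
      by (simp add: power_minus[of x] field_simps)
  qed
  have t_odd: "t (Suc (2 * r)) = - (2 * Gamma (1 / 2 + real \<nu>) * x powr (1 / 2)) * hyp r" for r
  proof -
    have "pochhammer (1 / 2 - real \<nu>) r * Gamma (1 / 2 + real \<nu> - real r) \<noteq> 0"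
      unfolding Gamma_half_pochhammer by (simp add: Gamma_nz)
    then have nz: "pochhammer (1 / 2 - real \<nu>) r \<noteq> 0" by auto
    have "t (Suc (2 * r)) = - Gamma (1 / 2 + real \<nu> - real r) / fact (Suc (2 * r)) * (z * z ^ (2 * r))"
      unfolding t_def p_def q_def alpha_odd by (simp add: beta_def del: fact_Suc)
    also have "Gamma (1 / 2 + real \<nu> - real r) = (- 1) ^ r * Gamma (1 / 2 + real \<nu>) / pochhammer (1 / 2 - real \<nu>) r"
      using Gamma_half_pochhammer[of \<nu> r] nz by (simp add: field_simps)
    finally show ?thesis
      unfolding z_even fact_Suc_double hyp_def hyp0F2_term_def x_powr
      by (simp add: power_minus[of x] field_simps)
  qed
  have t_large: "t (2 * (r + (\<nu> + 1))) = pi powr (- 1 / 2) * x ^ (1 + \<nu>) * ser r" for r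
  proof -
    define j where "j = r + \<nu> + 1"
    have c: "alpha \<nu> (2 * j) = (- 1) ^ r / fact r * (harm r - 3 * euler_mascheroni)"
      "beta \<nu> (2 * j) = (- 1) ^ r / fact r * (- 2)"
      by (simp_all add: alpha_def beta_def j_def Let_def)
    have "t (2 * j) = (- 1) ^ r / (fact r * fact (2 * j)) * z ^ (2 * j)
        * (harm r - 3 * euler_mascheroni + 2 * harm (2 * j) - 2 * ln z)"
      unfolding t_def p_def q_def c by (simp add: field_simps)
    also have "harm r - 3 * euler_mascheroni + 2 * harm (2 * j) - 2 * ln z = - ln x + A_coeff \<nu> r"
      unfolding x_def ln_plus_A_coeff[OF assms] j_def ..
    also have "(- 1) ^ r / (fact r * fact (2 * j)) * z ^ (2 * j) = pi powr (- 1 / 2) * x ^ j * B_coeff \<nu> r"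
      unfolding B_coeff_eq z_even j_def [symmetric] by (simp add: powr_minus powr_half_sqrt field_simps)
    finally show ?thesis by (simp add: ser_def j_def power_add mult_ac)
  qed
  \<comment> \<open>Convergence is inherited from the subseries of \<open>t\<close>, as the constant
    factor in \<open>t_odd\<close> is nonzero.\<close>
  have "summable hyp"
  proof -
    have "summable (\<lambda>r. t (Suc (2 * r)))" by (rule sub) (simp add: inj_def)
    then show ?thesis unfolding t_odd using x Gamma_nz by (subst (asm) summable_cmult_iff) auto
  qed
  have s_large: "summable (\<lambda>r. t (2 * (r + (\<nu> + 1))))" by (rule sub) (simp add: inj_def)
  then have "summable ser"
    unfolding t_large using x by (subst (asm) summable_cmult_iff) auto
  have s_even: "summable (\<lambda>n. t (2 * n))" by (rule sub) (simp add: inj_def)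
  have s_odd: "summable (\<lambda>n. t (Suc (2 * n)))" by (rule sub) (simp add: inj_def)
  have "I1 z (real \<nu>) = (\<Sum>n. t (2 * n)) + (\<Sum>n. t (Suc (2 * n)))"
    unfolding sum_t by (rule suminf_even_odd[OF s_even s_odd])
  also have "(\<Sum>n. t (2 * n)) = (\<Sum>r. t (2 * (r + (\<nu> + 1)))) + (\<Sum>j<\<nu> + 1. t (2 * j))"
    by (rule suminf_split_initial_segment[OF s_even])
  also have "(\<Sum>r. t (2 * (r + (\<nu> + 1)))) = pi powr (- 1 / 2) * x ^ (1 + \<nu>) * (\<Sum>r. ser r)"
    unfolding t_large by (rule suminf_mult[OF \<open>summable ser\<close>])
  also have "(\<Sum>n. t (Suc (2 * n))) = - (2 * Gamma (1 / 2 + real \<nu>) * x powr (1 / 2)) * (\<Sum>r. hyp r)"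
    unfolding t_odd by (rule suminf_mult[OF \<open>summable hyp\<close>])
  also have "{..<\<nu> + 1} = {0..\<nu>}" by auto
  also have "(\<Sum>j=0..\<nu>. t (2 * j)) = Gamma (1 + real \<nu>) *
      (\<Sum>r=0..\<nu>. 1 / (pochhammer (1 / 2) r * pochhammer (- real \<nu>) r * fact r) * (- x) ^ r)"
    unfolding sum_distrib_left by (intro sum.cong t_small) auto
  finally have "I1 z (real \<nu>) = Gamma (1 + real \<nu>) *
      (\<Sum>r=0..\<nu>. 1 / (pochhammer (1 / 2) r * pochhammer (- real \<nu>) r * fact r) * (- x) ^ r)
      - 2 * Gamma (1 / 2 + real \<nu>) * x powr (1 / 2) * hyp0F2 (3 / 2) (1 / 2 - real \<nu>) (- x)
      + pi powr (- 1 / 2) * x ^ (1 + \<nu>) * (\<Sum>r. ser r)"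
    by (simp add: hyp_def hyp0F2_def)
  moreover have "I1_converges z (real \<nu>)"
    using set_integrable_I1_kernel(1)[OF assms, of "real \<nu>"]
    by (simp add: I1_converges_def I1_kernel_def [abs_def])
  ultimately show ?thesis
    using \<open>summable hyp\<close> \<open>summable ser\<close> unfolding hyp_def ser_def x_def by blast
qed

end
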